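(* Let $G$ be the Heisenberg group of dimension $2n+1$ and $H$ a non-trivial connected closed subgroup of $G$ with Lie algebra $\mathfrak{h}$. Fix a Heisenberg basis of $\mathfrak{g}$ adapted to $\mathfrak{h}$, let $\mathfrak{q}$ be the real span of the elements of this basis not lying in $\mathfrak{h}$, and let $Q=\langle\exp\mathfrak{q}\rangle$ be the subgroup of $G$ generated by $\exp\mathfrak{q}$. Suppose that the quasi-regular representation $\pi_H$ of $G$ is multiplicity-free. Then: (1) $\operatorname{rank}(\operatorname{Supp}(\pi_H))=\dim G/H$. (2) One can find a slice $S$ of dimension $\operatorname{rank}(\operatorname{Supp}(\pi_H))$ for the strongly visible $Q$-action on $G^{\mathbb{C}}/H^{\mathbb{C}}$.
   Context: Let $n\ge 1$ and let $G=\mathbf{H}_n=\exp\mathfrak{g}$ be the connected, simply connected Heisenberg group of dimension $2n+1$ with Lie algebra $\mathfrak{g}$. A Heisenberg basis of $\mathfrak{g}$ is a basis $X_1,\dots,X_n,Y_1,\dots,Y_n,Z$ with $[X_i,Y_j]=\delta_{ij}Z$ and all other brackets of basis elements zero. A connected closed subgroup is $H=\exp\mathfrak{h}$ for a subalgebra $\mathfrak{h}$; non-trivial means $H\neq\{e\}$, $H\ne G$. A Heisenberg basis is adapted to $\mathfrak{h}$ if $\mathfrak{h}$ is the real span of one of the subsets: $\{Z\}$; $\{X_1,\dots,X_p,Y_1,\dots,Y_q,Z\}$ with $1\le p\le q\le n$, $(p,q)\ne(n,n)$; $\{X_1,\dots,X_m,Z\}$ with $1\le m\le n$; $\{X_1,\dots,X_m\}$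 with $1\le m\le n$. (Every non-trivial subalgebra admits one.) $G^{\mathbb{C}}=\exp\mathfrak{g}^{\mathbb{C}}$ is the simply connected complex Lie group with Lie algebra the complexification $\mathfrak{g}^{\mathbb{C}}$, $H^{\mathbb{C}}=\exp\mathfrak{h}^{\mathbb{C}}$, and subgroups of $G$ act on $G^{\mathbb{C}}/H^{\mathbb{C}}$ by left translation. The quasi-regular representation is the unitary representation of $G$ on $L^2(G/H)$ ($G$-invariant measure) given by $[\pi_H(g)f](xH)=f(g^{-1}xH)$. A unitary representation is multiplicity-free if its algebra of bounded intertwining endomorphisms is commutative. A holomorphic action of a Lie group $L$ on a connected complex manifold $D$ is strongly visible if there exist a real submanifold $S$ in $D$ and an anti-holomorphic diffeomorphism $\sigma$ of $D$ such that: (V.0) $D':=L\cdot S$ is a non-empty open set in $D$; (S.1) $\sigma|_S=\operatorname{id}_S$; (S.2) $\sigma$ preserves each $L$-orbit in $D'$. Such an $S$ is called a slice. Support and rank: let $X_i^*,Y_j^*,Z^*$ be the dual basis of $\mathfrak{g}^*$ and let $\xi(\boldsymbol\alpha,\boldsymbol\beta,\gamma)=\sum\alpha_iX_i^*+\sum\beta_jY_j^*+\gamma Z^*$. Let $\mathfrak{q}^*\subset\mathfrak{g}^*$ be the span of the dual basis elements corresponding to the basis elements in $\mathfrak{q}$. $G$ acts on $\mathfrak{g}^*$ by the coadjoint action. A cross-section of $\mathfrak{g}^*/G$ is $R=\{\xi(\boldsymbol0,\boldsymbol0,\gamma):\gamma\in\mathbb{R}\setminus\{0\}\}\sqcup\{\xi(\boldsymbol\alpha,\boldsymbol\beta,0):\boldsymbol\alpha,\boldsymbol\beta\in\mathbb{R}^n\}$;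 put $R(\mathfrak{q}^* )=R\cap(G\cdot\mathfrak{q}^* )$ (a subset of $\mathfrak{q}^*$ when $\pi_H$ is multiplicity-free). For $\xi\in R$ let $\tau_\xi\in\widehat{G}$ be the irreducible unitary representation attached to $G\cdot\xi$ by the Kirillov orbit method. By the Corwin–Greenleaf formula, $\pi_H\simeq\int^{\oplus}_{(G\cdot\mathfrak{q}^* )/G}m_{\pi_H}(\xi)\tau_\xi\,d\xi$ with $m_{\pi_H}$ the multiplicity function. $\operatorname{Supp}(\pi_H)=\{\tau_\xi:\xi\in R(\mathfrak{q}^* ),\,m_{\pi_H}(\xi)\ne0\}$, and $\operatorname{rank}(\operatorname{Supp}(\pi_H))$ is the number of elements of a minimal finite linearly independent subset of $\mathfrak{q}^*$ such that every element of $R(\mathfrak{q}^* )$ is a linear combination of it. *)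

theory Defs
  imports
    "HOL-Analysis.Analysis"
    "HOL-Algebra.Generated_Groups"
    "HOL-Algebra.Left_Coset"
begin

section \<open>The Heisenberg Lie algebra and the Heisenberg group\<close>

text \<open>
  The \<open>2n+1\<close> coordinates, where \<open>n = CARD('n)\<close>, are indexed by \<open>'n + 'n + unit\<close>. The scalar type
  \<open>'k\<close> is \<open>real\<close> for the Lie algebra and \<open>complex\<close> for its complexification.
\<close>

type_synonym ('k, 'n) heis = "('k, 'n + 'n + unit) vec"

definition heis_bracket :: "('k::comm_ring_1, 'n::finite) heis \<Rightarrow> ('k, 'n) heis \<Rightarrow> ('k, 'n) heis" where
  "heis_bracket u v = (\<chi> k. case k of
      Inr (Inr _) \<Rightarrow> (\<Sum>i\<in>UNIV. u $ Inl i * v $ Inr (Inl i) - v $ Inl i * u $ Inr (Inl i))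
    | _ \<Rightarrow> 0)"

text \<open>
  The simply connected group is realised in exponential coordinates: its underlying set is the
  Lie algebra, the product is given by the Baker-Campbell-Hausdorff series (which stops after the
  first bracket), and the one-parameter subgroups are the maps \<open>t \<mapsto> t v\<close>. Hence \<open>heis_exp\<close>,
  which sends a Lie algebra element to a group element, is the identity in these coordinates.
\<close>

definition heis_group :: "(('k::field, 'n::finite) heis) monoid" where
  "heis_group = \<lparr>carrier = UNIV, mult = (\<lambda>u v. u + v + (1/2) *s heis_bracket u v), one = 0\<rparr>"

definition heis_exp :: "('k::field, 'n::finite) heis \<Rightarrow> ('k, 'n) heis" where
  "heis_exp v = v"

definition lie_subalgebra :: "(real, 'n::finite) heis set \<Rightarrow> bool" where
  "lie_subalgebra h \<longleftrightarrow> subspace h \<and> (\<forall>u\<in>h. \<forall>v\<in>h. heis_bracket u v \<in> h)"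

definition basis_set :: "(nat \<Rightarrow> (real, 'n::finite) heis) \<Rightarrow> (nat \<Rightarrow> (real, 'n) heis) \<Rightarrow> (real, 'n) heis
    \<Rightarrow> (real, 'n) heis set" where
  "basis_set X Y Z = X ` {1..CARD('n)} \<union> Y ` {1..CARD('n)} \<union> {Z}"

text \<open>
  As the whole space has dimension \<open>2n+1\<close>, the first two conditions force the \<open>2n+1\<close> vectors
  to be pairwise distinct.
\<close>

definition heisenberg_basis :: "(nat \<Rightarrow> (real, 'n::finite) heis) \<Rightarrow> (nat \<Rightarrow> (real, 'n) heis)
    \<Rightarrow> (real, 'n) heis \<Rightarrow> bool" where
  "heisenberg_basis X Y Z \<longleftrightarrow>
     independent (basis_set X Y Z) \<and> span (basis_set X Y Z) = UNIV \<and>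
     (\<forall>i\<in>{1..CARD('n)}. \<forall>j\<in>{1..CARD('n)}.
        heis_bracket (X i) (Y j) = (if i = j then Z else 0) \<and>
        heis_bracket (X i) (X j) = 0 \<and> heis_bracket (Y i) (Y j) = 0) \<and>
     (\<forall>i\<in>{1..CARD('n)}. heis_bracket (X i) Z = 0 \<and> heis_bracket (Y i) Z = 0)"

definition adapted_basis :: "(real, 'n::finite) heis set \<Rightarrow> (nat \<Rightarrow> (real, 'n) heis)
    \<Rightarrow> (nat \<Rightarrow> (real, 'n) heis) \<Rightarrow> (real, 'n) heis \<Rightarrow> bool" where
  "adapted_basis h X Y Z \<longleftrightarrow> heisenberg_basis X Y Z \<and>
     (h = span {Z} \<or>
      (\<exists>p q. 1 \<le> p \<and> p \<le> q \<and> q \<le> CARD('n) \<and> (p, q) \<noteq> (CARD('n), CARD('n)) \<and>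
         h = span (X ` {1..p} \<union> Y ` {1..q} \<union> {Z})) \<or>
      (\<exists>m. 1 \<le> m \<and> m \<le> CARD('n) \<and> h = span (X ` {1..m} \<union> {Z})) \<or>
      (\<exists>m. 1 \<le> m \<and> m \<le> CARD('n) \<and> h = span (X ` {1..m})))"

text \<open>The inclusion of the real Lie algebra (group) in its complexification.\<close>

definition complexify :: "real ^ 'm \<Rightarrow> complex ^ 'm" where
  "complexify v = (\<chi> i. complex_of_real (v $ i))"

definition complexification :: "(real ^ 'm) set \<Rightarrow> (complex ^ 'm) set" where
  "complexification h = {complexify u + \<i> *s complexify v | u v. u \<in> h \<and> v \<in> h}"

section \<open>Homogeneous spaces\<close>

text \<open>
  Points of \<open>G/H\<close> are left cosets \<open>x <#\<^bsub>G\<^esub> H\<close>; the translate of a coset \<open>C\<close> by \<open>g\<close> is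
  \<open>g <#\<^bsub>G\<^esub> C\<close>. The groups here have carrier \<open>UNIV\<close>.
\<close>

definition coset_topology :: "('a::topological_space) monoid \<Rightarrow> 'a set \<Rightarrow> 'a set topology" where
  "coset_topology G H =
     topology (\<lambda>U. U \<subseteq> lcosets\<^bsub>G\<^esub> H \<and> open {x. x <#\<^bsub>G\<^esub> H \<in> U})"

section \<open>The quasi-regular representation\<close>

text \<open>Non-zero invariant Radon measures on \<open>G/H\<close>.\<close>

definition invariant_measure :: "('a::topological_space) monoid \<Rightarrow> 'a set \<Rightarrow> 'a set measure \<Rightarrow> bool" where
  "invariant_measure G H \<mu> \<longleftrightarrow>
     space \<mu> = lcosets\<^bsub>G\<^esub> H \<and>
     sets \<mu> = sigma_sets (lcosets\<^bsub>G\<^esub> H) {U. openin (coset_topology G H) U} \<and>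
     (\<forall>K. compactin (coset_topology G H) K \<longrightarrow> emeasure \<mu> K < \<infinity>) \<and>
     emeasure \<mu> (space \<mu>) \<noteq> 0 \<and>
     (\<forall>g\<in>carrier G. \<forall>A\<in>sets \<mu>. emeasure \<mu> ((\<lambda>C. g <#\<^bsub>G\<^esub> C) ` A) = emeasure \<mu> A)"

definition quasi_regular :: "'a monoid \<Rightarrow> 'a \<Rightarrow> ('a set \<Rightarrow> complex) \<Rightarrow> 'a set \<Rightarrow> complex" where
  "quasi_regular G g f = (\<lambda>C. f ((inv\<^bsub>G\<^esub> g) <#\<^bsub>G\<^esub> C))"

text \<open>
  Elements of \<open>L\<^sup>2(\<mu>)\<close> are handled through square-integrable representatives, with equality
  almost everywhere. Linearity together with boundedness makes the operators below
  compatible with equality almost everywhere.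
\<close>

definition L2_functions :: "'p measure \<Rightarrow> ('p \<Rightarrow> complex) set" where
  "L2_functions \<mu> = {f \<in> borel_measurable \<mu>. integrable \<mu> (\<lambda>x. (cmod (f x))\<^sup>2)}"

definition bounded_L2_operator :: "'p measure \<Rightarrow> (('p \<Rightarrow> complex) \<Rightarrow> 'p \<Rightarrow> complex) \<Rightarrow> bool" where
  "bounded_L2_operator \<mu> T \<longleftrightarrow>
     (\<forall>f\<in>L2_functions \<mu>. T f \<in> L2_functions \<mu>) \<and>
     (\<forall>a b. \<forall>f\<in>L2_functions \<mu>. \<forall>g\<in>L2_functions \<mu>.
        AE x in \<mu>. T (\<lambda>y. a * f y + b * g y) x = a * T f x + b * T g x) \<and>
     (\<exists>K\<ge>0. \<forall>f\<in>L2_functions \<mu>.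
        sqrt (\<integral>x. (cmod (T f x))\<^sup>2 \<partial>\<mu>) \<le> K * sqrt (\<integral>x. (cmod (f x))\<^sup>2 \<partial>\<mu>))"

definition intertwining_endomorphism :: "'a monoid \<Rightarrow> 'p measure
    \<Rightarrow> ('a \<Rightarrow> ('p \<Rightarrow> complex) \<Rightarrow> 'p \<Rightarrow> complex) \<Rightarrow> (('p \<Rightarrow> complex) \<Rightarrow> 'p \<Rightarrow> complex) \<Rightarrow> bool" where
  "intertwining_endomorphism G \<mu> \<pi> T \<longleftrightarrow> bounded_L2_operator \<mu> T \<and>
     (\<forall>g\<in>carrier G. \<forall>f\<in>L2_functions \<mu>. AE x in \<mu>. T (\<pi> g f) x = \<pi> g (T f) x)"

definition multiplicity_free :: "'a monoid \<Rightarrow> 'p measure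
    \<Rightarrow> ('a \<Rightarrow> ('p \<Rightarrow> complex) \<Rightarrow> 'p \<Rightarrow> complex) \<Rightarrow> bool" where
  "multiplicity_free G \<mu> \<pi> \<longleftrightarrow>
     (\<forall>T T'. intertwining_endomorphism G \<mu> \<pi> T \<and> intertwining_endomorphism G \<mu> \<pi> T' \<longrightarrow>
        (\<forall>f\<in>L2_functions \<mu>. AE x in \<mu>. T (T' f) x = T' (T f) x))"

section \<open>Coadjoint orbits and the rank of the support\<close>

text \<open>The adjoint action is characterised by \<open>exp (Ad g w) = g (exp w) g\<^sup>-\<^sup>1\<close>.\<close>

definition heis_Ad :: "(real, 'n::finite) heis \<Rightarrow> (real, 'n) heis \<Rightarrow> (real, 'n) heis" where
  "heis_Ad g w = inv_into UNIV heis_exp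
     (g \<otimes>\<^bsub>heis_group\<^esub> heis_exp w \<otimes>\<^bsub>heis_group\<^esub> inv\<^bsub>heis_group\<^esub> g)"

definition coadjoint :: "(real, 'n::finite) heis \<Rightarrow> ((real, 'n) heis \<Rightarrow>\<^sub>L real) \<Rightarrow> (real, 'n) heis \<Rightarrow>\<^sub>L real" where
  "coadjoint g \<xi> = Blinfun (\<lambda>w. blinfun_apply \<xi> (heis_Ad (inv\<^bsub>heis_group\<^esub> g) w))"

definition dual_vector :: "('v::real_normed_vector) set \<Rightarrow> 'v \<Rightarrow> 'v \<Rightarrow>\<^sub>L real" where
  "dual_vector B b = (THE \<xi>. \<forall>b'\<in>B. blinfun_apply \<xi> b' = (if b' = b then 1 else 0))"

definition xi :: "(nat \<Rightarrow> (real, 'n::finite) heis) \<Rightarrow> (nat \<Rightarrow> (real, 'n) heis) \<Rightarrow> (real, 'n) heis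
    \<Rightarrow> (nat \<Rightarrow> real) \<Rightarrow> (nat \<Rightarrow> real) \<Rightarrow> real \<Rightarrow> (real, 'n) heis \<Rightarrow>\<^sub>L real" where
  "xi X Y Z \<alpha> \<beta> \<gamma> =
     (\<Sum>i=1..CARD('n). \<alpha> i *\<^sub>R dual_vector (basis_set X Y Z) (X i)) +
     (\<Sum>j=1..CARD('n). \<beta> j *\<^sub>R dual_vector (basis_set X Y Z) (Y j)) +
     \<gamma> *\<^sub>R dual_vector (basis_set X Y Z) Z"

definition cross_section :: "(nat \<Rightarrow> (real, 'n::finite) heis) \<Rightarrow> (nat \<Rightarrow> (real, 'n) heis)
    \<Rightarrow> (real, 'n) heis \<Rightarrow> ((real, 'n) heis \<Rightarrow>\<^sub>L real) set" where
  "cross_section X Y Z =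
     {xi X Y Z (\<lambda>_. 0) (\<lambda>_. 0) \<gamma> | \<gamma>. \<gamma> \<noteq> 0} \<union> {xi X Y Z \<alpha> \<beta> 0 | \<alpha> \<beta>. True}"

definition dual_of :: "(nat \<Rightarrow> (real, 'n::finite) heis) \<Rightarrow> (nat \<Rightarrow> (real, 'n) heis) \<Rightarrow> (real, 'n) heis
    \<Rightarrow> (real, 'n) heis set \<Rightarrow> ((real, 'n) heis \<Rightarrow>\<^sub>L real) set" where
  "dual_of X Y Z q = span (dual_vector (basis_set X Y Z) ` (basis_set X Y Z \<inter> q))"

definition orbit_parameters :: "(nat \<Rightarrow> (real, 'n::finite) heis) \<Rightarrow> (nat \<Rightarrow> (real, 'n) heis)
    \<Rightarrow> (real, 'n) heis \<Rightarrow> (real, 'n) heis set \<Rightarrow> ((real, 'n) heis \<Rightarrow>\<^sub>L real) set" where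
  "orbit_parameters X Y Z q = cross_section X Y Z \<inter>
     {coadjoint g \<xi> | g \<xi>. \<xi> \<in> dual_of X Y Z q}"

text \<open>
  The rank of the support of the quasi-regular representation is by definition a property of the
  set \<open>R(q\<^sup>*)\<close> (\<open>orbit_parameters\<close>) of parameters of the representations occurring
  in the support: the least number of elements of a finite linearly independent subset of \<open>q\<^sup>*\<close>
  whose linear combinations exhaust \<open>R(q\<^sup>*)\<close>.
\<close>

definition rank_Supp :: "(nat \<Rightarrow> (real, 'n::finite) heis) \<Rightarrow> (nat \<Rightarrow> (real, 'n) heis)
    \<Rightarrow> (real, 'n) heis \<Rightarrow> (real, 'n) heis set \<Rightarrow> nat" where
  "rank_Supp X Y Z q = (LEAST k. \<exists>B. B \<subseteq> dual_of X Y Z q \<and> finite B \<and> independent B \<and> card B = k \<and>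
     orbit_parameters X Y Z q \<subseteq> span B)"

section \<open>Complex manifolds\<close>

text \<open>
  Maps between open subsets of complex subspaces of \<open>complex ^ 'm\<close> (hence the
  derivative within the set): complex differentiable, respectively
  real differentiable with conjugate-linear derivative.
\<close>

definition holomorphic_map_on :: "(complex ^ 'm \<Rightarrow> complex ^ 'l) \<Rightarrow> (complex ^ 'm) set \<Rightarrow> bool" where
  "holomorphic_map_on f S \<longleftrightarrow>
     (\<forall>x\<in>S. \<exists>f'. (\<forall>c v. f' (c *s v) = c *s f' v) \<and> (f has_derivative f') (at x within S))"

definition antiholomorphic_map_on :: "(complex ^ 'm \<Rightarrow> complex ^ 'l) \<Rightarrow> (complex ^ 'm) set \<Rightarrow> bool" where
  "antiholomorphic_map_on f S \<longleftrightarrow>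
     (\<forall>x\<in>S. \<exists>f'. (\<forall>c v. f' (c *s v) = cnj c *s f' v) \<and> (f has_derivative f') (at x within S))"

text \<open>
  A chart is a pair of a domain and a coordinate map. Charts of a \<open>d\<close>-dimensional manifold take
  values in \<open>d\<close>-dimensional complex subspaces of \<open>complex ^ 'm\<close>, because the dimension of \<open>G/H\<close>
  is not a type parameter.
\<close>

type_synonym ('p, 'm) chart = "'p set \<times> ('p \<Rightarrow> complex ^ 'm)"

definition complex_chart :: "'p topology \<Rightarrow> nat \<Rightarrow> ('p, 'm::finite) chart \<Rightarrow> bool" where
  "complex_chart M d c \<longleftrightarrow> (case c of (U, \<phi>) \<Rightarrow>
     openin M U \<and>
     (\<exists>T. vec.subspace T \<and> vec.dim T = d \<and> openin (top_of_set T) (\<phi> ` U)) \<and>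
     homeomorphic_map (subtopology M U) (top_of_set (\<phi> ` U)) \<phi>)"

definition complex_manifold :: "'p topology \<Rightarrow> nat \<Rightarrow> ('p, 'm::finite) chart set \<Rightarrow> bool" where
  "complex_manifold M d \<A> \<longleftrightarrow>
     Hausdorff_space M \<and> second_countable M \<and>
     (\<forall>c\<in>\<A>. complex_chart M d c) \<and> (\<Union>c\<in>\<A>. fst c) = topspace M \<and>
     (\<forall>(U, \<phi>)\<in>\<A>. \<forall>(V, \<psi>)\<in>\<A>. holomorphic_map_on (\<psi> \<circ> inv_into U \<phi>) (\<phi> ` (U \<inter> V)))"

definition locally_in_charts :: "((complex ^ 'm \<Rightarrow> complex ^ 'm) \<Rightarrow> (complex ^ 'm) set \<Rightarrow> bool)
    \<Rightarrow> 'p topology \<Rightarrow> ('p, 'm::finite) chart set \<Rightarrow> ('p \<Rightarrow> 'p) \<Rightarrow> bool" where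
  "locally_in_charts P M \<A> f \<longleftrightarrow> f ` topspace M \<subseteq> topspace M \<and>
     (\<forall>x\<in>topspace M. \<exists>(U, \<phi>)\<in>\<A>. \<exists>(V, \<psi>)\<in>\<A>. \<exists>W.
        openin M W \<and> x \<in> W \<and> W \<subseteq> U \<and> f ` W \<subseteq> V \<and> P (\<psi> \<circ> f \<circ> inv_into U \<phi>) (\<phi> ` W))"

abbreviation holomorphic_self_map where
  "holomorphic_self_map \<equiv> locally_in_charts holomorphic_map_on"

definition antiholomorphic_diffeo :: "'p topology \<Rightarrow> ('p, 'm::finite) chart set \<Rightarrow> ('p \<Rightarrow> 'p) \<Rightarrow> bool" where
  "antiholomorphic_diffeo M \<A> \<sigma> \<longleftrightarrow> bij_betw \<sigma> (topspace M) (topspace M) \<and>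
     locally_in_charts antiholomorphic_map_on M \<A> \<sigma> \<and>
     locally_in_charts antiholomorphic_map_on M \<A> (inv_into (topspace M) \<sigma>)"

text \<open>Infinitely differentiable maps on open subsets of Euclidean spaces.\<close>

primrec C_k_on :: "nat \<Rightarrow> ('a::euclidean_space \<Rightarrow> 'b::real_normed_vector) \<Rightarrow> 'a set \<Rightarrow> bool" where
  "C_k_on 0 f S = continuous_on S f"
| "C_k_on (Suc k) f S =
     (f differentiable_on S \<and> (\<forall>v. C_k_on k (\<lambda>x. frechet_derivative f (at x) v) S))"

definition C_infinity_on :: "('a::euclidean_space \<Rightarrow> 'b::real_normed_vector) \<Rightarrow> 'a set \<Rightarrow> bool" where
  "C_infinity_on f S \<longleftrightarrow> (\<forall>k. C_k_on k f S)"

definition euclidean_submanifold :: "nat \<Rightarrow> ('a::euclidean_space) set \<Rightarrow> bool" where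
  "euclidean_submanifold k N \<longleftrightarrow>
     (\<forall>x\<in>N. \<exists>W W' \<Phi> \<Psi> K. open W \<and> x \<in> W \<and> open W' \<and> homeomorphism W W' \<Phi> \<Psi> \<and>
        C_infinity_on \<Phi> W \<and> C_infinity_on \<Psi> W' \<and>
        subspace K \<and> dim K = k \<and> \<Phi> ` (W \<inter> N) = W' \<inter> (K :: 'a set))"

text \<open>
  Real (embedded) submanifolds of real dimension \<open>k\<close>. Charts take values in linear subspaces,
  and a subset of a linear subspace is a submanifold of it iff it is a
  submanifold of the ambient Euclidean space.
\<close>

definition real_submanifold :: "'p topology \<Rightarrow> ('p, 'm::finite) chart set \<Rightarrow> nat \<Rightarrow> 'p set \<Rightarrow> bool" where
  "real_submanifold M \<A> k S \<longleftrightarrow> S \<subseteq> topspace M \<and>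
     (\<forall>p\<in>S. \<exists>(U, \<phi>)\<in>\<A>. p \<in> U \<and> euclidean_submanifold k (\<phi> ` (S \<inter> U)))"

text \<open>
  The complex manifold structure of a homogeneous space of a complex Lie group with underlying
  manifold \<open>complex ^ 'm\<close>: the charts are those for which the quotient map, read in the chart,
  is holomorphic and has local holomorphic sections, so that the quotient map is a
  holomorphic submersion.
\<close>

definition coset_charts :: "(complex ^ 'm::finite) monoid \<Rightarrow> (complex ^ 'm) set \<Rightarrow> nat
    \<Rightarrow> ((complex ^ 'm) set, 'm) chart set" where
  "coset_charts G H d = {(U, \<phi>). complex_chart (coset_topology G H) d (U, \<phi>) \<and>
     holomorphic_map_on (\<lambda>x. \<phi> (x <#\<^bsub>G\<^esub> H)) {x. x <#\<^bsub>G\<^esub> H \<in> U} \<and>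
     (\<forall>p\<in>U. \<exists>W s. openin (top_of_set (\<phi> ` U)) W \<and> \<phi> p \<in> W \<and> holomorphic_map_on s W \<and>
        (\<forall>w\<in>W. s w <#\<^bsub>G\<^esub> H \<in> U \<and> \<phi> (s w <#\<^bsub>G\<^esub> H) = w))}"

section \<open>Strongly visible actions\<close>

definition holomorphic_action :: "'p topology \<Rightarrow> ('p, 'm::finite) chart set
    \<Rightarrow> ('l::topological_space) monoid \<Rightarrow> ('l \<Rightarrow> 'p \<Rightarrow> 'p) \<Rightarrow> bool" where
  "holomorphic_action M \<A> L act \<longleftrightarrow> group L \<and>
     (\<forall>p\<in>topspace M. act \<one>\<^bsub>L\<^esub> p = p) \<and>
     (\<forall>l\<in>carrier L. \<forall>l'\<in>carrier L. \<forall>p\<in>topspace M. act (l \<otimes>\<^bsub>L\<^esub> l') p = act l (act l' p)) \<and>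
     (\<forall>l\<in>carrier L. holomorphic_self_map M \<A> (act l)) \<and>
     continuous_map (prod_topology (top_of_set (carrier L)) M) M (\<lambda>(l, p). act l p)"

definition group_orbit :: "'l monoid \<Rightarrow> ('l \<Rightarrow> 'p \<Rightarrow> 'p) \<Rightarrow> 'p \<Rightarrow> 'p set" where
  "group_orbit L act p = (\<lambda>l. act l p) ` carrier L"

definition visible_slice :: "'p topology \<Rightarrow> ('p, 'm::finite) chart set
    \<Rightarrow> 'l monoid \<Rightarrow> ('l \<Rightarrow> 'p \<Rightarrow> 'p) \<Rightarrow> nat \<Rightarrow> 'p set \<Rightarrow> bool" where
  "visible_slice M \<A> L act k S \<longleftrightarrow> real_submanifold M \<A> k S \<and>
     (\<exists>\<sigma>. antiholomorphic_diffeo M \<A> \<sigma> \<and>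
       (let D' = (\<Union>s\<in>S. group_orbit L act s) in
          D' \<noteq> {} \<and> openin M D' \<and>
          (\<forall>s\<in>S. \<sigma> s = s) \<and>
          (\<forall>p\<in>D'. \<sigma> ` group_orbit L act p = group_orbit L act p)))"

definition strongly_visible :: "'p topology \<Rightarrow> nat \<Rightarrow> ('p, 'm::finite) chart set
    \<Rightarrow> ('l::topological_space) monoid \<Rightarrow> ('l \<Rightarrow> 'p \<Rightarrow> 'p) \<Rightarrow> bool" where
  "strongly_visible M d \<A> L act \<longleftrightarrow>
     complex_manifold M d \<A> \<and> connected_space M \<and> holomorphic_action M \<A> L act \<and>
     (\<exists>k S. visible_slice M \<A> L act k S)"

end

theory Submission
  imports Defs
begin

text \<open>
  Either \<open>h\<close> contains the centre, and then every bracket lies in \<open>h\<close> and \<open>G/H\<close> is a vector group,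
  or \<open>h\<close> is spanned by \<open>X\<^sub>1, \<dots>, X\<^sub>m\<close>. Multiplicity-freeness forces \<open>m = n\<close> in the second
  case.

  If \<open>m < n\<close>, then \<open>X\<^sub>n\<close> and \<open>Y\<^sub>n\<close> commute with \<open>h\<close>, so that right translations by their
  exponentials act on \<open>G/H\<close>. They commute with the action of \<open>G\<close>, but not with each other: their
  commutator is a central element outside \<open>H\<close>, and a large central element moves the image of a
  ball off itself (\<open>not_multiplicity_free\<close>). What has to be shown is that they are bounded on
  \<open>L\<^sup>2\<close>, although only left invariance of \<open>\<mu>\<close> is given. Now a right translation differs from a left
  translation by a map that moves each point along the flow of the centre for a time that is
  constant on the flow lines. Such a map preserves \<open>\<mu>\<close>: this is clear when the time takes countably
  many values, and the general case follows by approximation (\<open>emeasure_flow_vimage_le\<close>).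

  In the remaining cases either all brackets lie in \<open>h\<close>, or all brackets lie in \<open>q\<close> while \<open>h\<close> and \<open>q\<close>
  are abelian. In both there is a polynomial map \<open>coord\<close> from \<open>G\<^sup>\<complex>\<close> onto the complexification of \<open>q\<close>
  whose fibres are the left cosets of \<open>H\<^sup>\<complex>\<close> and which turns left translation by \<open>g \<in> Q\<close> into
  translation by the \<open>q\<close>-component of \<open>g\<close> (\<open>fibre_coord\<close>, \<open>coord_translate\<close>). Hence the action of
  \<open>Q\<close> is the action of \<open>q\<close> on \<open>q + iq\<close> by real translations. The imaginary part \<open>iq\<close> is a slice
  of dimension \<open>dim q\<close>, with \<open>w \<mapsto> - cnj w\<close> as anti-holomorphic diffeomorphism
  (\<open>visible_slice_slice\<close>).

  For the rank, the coadjoint action changes a functional by a multiple of its value at \<open>Z\<close> only.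
  It therefore fixes the elements of \<open>q\<^sup>*\<close> that vanish at \<open>Z\<close>; the orbits of the others meet the
  cross-section in multiples of \<open>Z\<^sup>*\<close>, and then \<open>Z\<^sup>*\<close> belongs to \<open>q\<^sup>*\<close>. So \<open>R(q\<^sup>*)\<close> is contained in \<open>q\<^sup>*\<close>.
  As it contains the dual basis of \<open>q\<^sup>*\<close>, the rank is \<open>dim q = dim G/H\<close> (\<open>rank_Supp_eq\<close>).
\<close>

section \<open>The Heisenberg bracket and group law\<close>

lemma heis_bracket_add_left: "heis_bracket (u + u') v = heis_bracket u v + heis_bracket u' v"
  by (simp add: heis_bracket_def vec_eq_iff sum.distrib [symmetric] algebra_simps split: sum.split)

lemma heis_bracket_skew: "heis_bracket v u = - heis_bracket u v"
  by (simp add: heis_bracket_def vec_eq_iff sum_negf [symmetric] algebra_simps split: sum.split)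

lemma heis_bracket_scale_left: "heis_bracket (c *s u) v = c *s heis_bracket u v"
  by (simp add: heis_bracket_def vec_eq_iff sum_distrib_left algebra_simps split: sum.split)

lemma heis_bracket_self [simp]: "heis_bracket u u = 0"
  by (simp add: heis_bracket_def vec_eq_iff split: sum.split)

lemma heis_bracket_add_right: "heis_bracket u (v + v') = heis_bracket u v + heis_bracket u v'"
  using heis_bracket_skew [of u] heis_bracket_add_left [of v v' u] by (simp add: heis_bracket_skew [of u])

lemma heis_bracket_scale_right: "heis_bracket u (c *s v) = c *s heis_bracket u v"
  by (simp add: heis_bracket_skew [of u] heis_bracket_scale_left vec.scale_minus_right)

lemma heis_bracket_minus_left: "heis_bracket (- u) v = - heis_bracket u v"
  by (simp add: heis_bracket_def vec_eq_iff sum_negf [symmetric] algebra_simps split: sum.split)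

lemma heis_bracket_minus_right: "heis_bracket u (- v) = - heis_bracket u v"
  by (simp add: heis_bracket_skew [of u] heis_bracket_minus_left)

lemma heis_bracket_diff_left: "heis_bracket (u - u') v = heis_bracket u v - heis_bracket u' v"
  using heis_bracket_add_left [of u "-u'" v] by (simp add: heis_bracket_minus_left)

lemma heis_bracket_diff_right: "heis_bracket u (v - v') = heis_bracket u v - heis_bracket u v'"
  using heis_bracket_add_right [of u v "-v'"] by (simp add: heis_bracket_minus_right)

lemma heis_bracket_0 [simp]: "heis_bracket 0 v = 0" "heis_bracket u 0 = 0"
  using heis_bracket_scale_left [of 0 0 v] heis_bracket_scale_right [of u 0 0] by auto

lemmas heis_bracket_bilinear =
  heis_bracket_add_left heis_bracket_add_right heis_bracket_scale_left heis_bracket_scale_right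
  heis_bracket_minus_left heis_bracket_minus_right heis_bracket_diff_left heis_bracket_diff_right

lemma heis_bracket_nested [simp]:
  "heis_bracket (heis_bracket u v) w = 0" "heis_bracket w (heis_bracket u v) = 0"
  by (simp_all add: heis_bracket_def vec_eq_iff split: sum.split)

lemma heis_bracket_scaleR:
  fixes u v :: "(real, 'n::finite) heis"
  shows "heis_bracket (c *\<^sub>R u) v = c *\<^sub>R heis_bracket u v"
    "heis_bracket u (c *\<^sub>R v) = c *\<^sub>R heis_bracket u v"
  using heis_bracket_scale_left [of c u v] heis_bracket_scale_right [of u c v]
  by (simp_all add: scalar_mult_eq_scaleR)

definition heis_center :: "('k::comm_ring_1, 'n::finite) heis" where
  "heis_center = axis (Inr (Inr ())) 1"

lemma heis_bracket_central: "\<exists>c. heis_bracket u v = c *s heis_center"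
proof
  show "heis_bracket u v = (heis_bracket u v $ Inr (Inr ())) *s heis_center"
    by (simp add: heis_bracket_def heis_center_def axis_def vec_eq_iff split: sum.split)
qed

lemma heis_bracket_center [simp]: "heis_bracket heis_center v = 0" "heis_bracket v heis_center = 0"
  by (simp_all add: heis_bracket_def heis_center_def axis_def vec_eq_iff split: sum.split)

lemma carrier_heis_group [simp]: "carrier heis_group = UNIV"
  and one_heis_group [simp]: "\<one>\<^bsub>heis_group\<^esub> = 0"
  by (simp_all add: heis_group_def)

lemma mult_heis_group: "u \<otimes>\<^bsub>heis_group\<^esub> v = u + v + (1/2) *s heis_bracket u v"
  by (simp add: heis_group_def)

lemma group_heis_group: "group (heis_group :: ('k::field, 'n::finite) heis monoid)"
proof (rule groupI)
  fix x :: "('k, 'n) heis"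
  have "- x \<otimes>\<^bsub>heis_group\<^esub> x = \<one>\<^bsub>heis_group\<^esub>"
    by (simp add: mult_heis_group heis_bracket_minus_left)
  then show "\<exists>y\<in>carrier heis_group. y \<otimes>\<^bsub>heis_group\<^esub> x = \<one>\<^bsub>heis_group\<^esub>" by auto
qed (auto simp: mult_heis_group heis_bracket_bilinear vec.scale_right_distrib)

lemma inv_heis_group [simp]: "inv\<^bsub>heis_group\<^esub> x = - (x :: ('k::field, 'n::finite) heis)"
  by (rule group.inv_equality [OF group_heis_group])
    (simp_all add: mult_heis_group heis_bracket_minus_left)

lemma heis_exp_image [simp]: "heis_exp ` A = A"
  by (simp add: heis_exp_def)

section \<open>Coset spaces\<close>

lemma istopology_coset:
  "istopology (\<lambda>U. U \<subseteq> lcosets\<^bsub>G\<^esub> H \<and> open {x. x <#\<^bsub>G\<^esub> H \<in> U})"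
  unfolding istopology_def
proof (intro conjI allI impI)
  fix \<K>
  assume K: "\<forall>U\<in>\<K>. U \<subseteq> lcosets\<^bsub>G\<^esub> H \<and> open {x. x <#\<^bsub>G\<^esub> H \<in> U}"
  then show "\<Union> \<K> \<subseteq> lcosets\<^bsub>G\<^esub> H" by auto
  have "{x. x <#\<^bsub>G\<^esub> H \<in> \<Union> \<K>} = (\<Union>U\<in>\<K>. {x. x <#\<^bsub>G\<^esub> H \<in> U})" by auto
  then show "open {x. x <#\<^bsub>G\<^esub> H \<in> \<Union> \<K>}" using K by auto
next
  fix U V
  assume "U \<subseteq> lcosets\<^bsub>G\<^esub> H \<and> open {x. x <#\<^bsub>G\<^esub> H \<in> U}"
    and "V \<subseteq> lcosets\<^bsub>G\<^esub> H \<and> open {x. x <#\<^bsub>G\<^esub> H \<in> V}"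
  then show "open {x. x <#\<^bsub>G\<^esub> H \<in> U \<inter> V}"
    by (auto simp: Collect_conj_eq intro: open_Int)
qed auto

lemma openin_coset_topology:
  "openin (coset_topology G H) U \<longleftrightarrow> U \<subseteq> lcosets\<^bsub>G\<^esub> H \<and> open {x. x <#\<^bsub>G\<^esub> H \<in> U}"
  unfolding coset_topology_def using istopology_coset [of G H] by (simp add: topology_inverse')

lemma lcosets_UNIV: "carrier G = UNIV \<Longrightarrow> lcosets\<^bsub>G\<^esub> H = range (\<lambda>x. x <#\<^bsub>G\<^esub> H)"
  by (auto simp: LCOSETS_def)

lemma topspace_coset_topology [simp]:
  assumes "carrier G = UNIV"
  shows "topspace (coset_topology G H) = lcosets\<^bsub>G\<^esub> H"
proof -
  have "openin (coset_topology G H) (lcosets\<^bsub>G\<^esub> H)"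
    by (simp add: openin_coset_topology lcosets_UNIV [OF assms])
  then show ?thesis
    by (metis openin_subset openin_topspace openin_coset_topology subset_antisym)
qed

lemma continuous_map_coset:
  assumes "carrier G = UNIV"
  shows "continuous_map euclidean (coset_topology G H) (\<lambda>x. x <#\<^bsub>G\<^esub> H)"
  unfolding continuous_map_def
  using assms by (auto simp: openin_coset_topology lcosets_UNIV)

section \<open>Coset spaces with a global flat chart\<close>

lemma holomorphic_map_on_cong:
  assumes "holomorphic_map_on f S" and "\<And>x. x \<in> S \<Longrightarrow> f x = g x"
  shows "holomorphic_map_on g S"
  using assms unfolding holomorphic_map_on_def by (metis has_derivative_transform)

lemma antiholomorphic_map_on_cong:
  assumes "antiholomorphic_map_on f S" and "\<And>x. x \<in> S \<Longrightarrow> f x = g x"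
  shows "antiholomorphic_map_on g S"
  using assms unfolding antiholomorphic_map_on_def by (metis has_derivative_transform)

lemma holomorphic_map_on_translation: "holomorphic_map_on (\<lambda>w. u + w) S"
  unfolding holomorphic_map_on_def
proof
  fix x
  have "((\<lambda>w. u + w) has_derivative (\<lambda>v. v)) (at x within S)"
    by (auto intro!: derivative_eq_intros)
  then show "\<exists>f'. (\<forall>c v. f' (c *s v) = c *s f' v) \<and> ((\<lambda>w. u + w) has_derivative f') (at x within S)"
    by (intro exI [of _ "\<lambda>v. v"]) simp
qed

text \<open>
  A change of charts factors through the group: a local section of the first chart is followed by
  the quotient map read in the second. Both are holomorphic by the choice of the charts.
\<close>

lemma coset_charts_transition:
  assumes U: "(U, \<phi>) \<in> coset_charts G H d" and V: "(V, \<psi>) \<in> coset_charts G H d"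
  shows "holomorphic_map_on (\<psi> \<circ> inv_into U \<phi>) (\<phi> ` (U \<inter> V))"
  unfolding holomorphic_map_on_def
proof
  fix w0 assume w0: "w0 \<in> \<phi> ` (U \<inter> V)"
  then obtain p where p: "p \<in> U" "p \<in> V" "w0 = \<phi> p" by auto
  have inj: "inj_on \<phi> U"
  proof -
    have "openin (coset_topology G H) U"
      and "homeomorphic_map (subtopology (coset_topology G H) U) (top_of_set (\<phi> ` U)) \<phi>"
      using U by (auto simp: coset_charts_def complex_chart_def)
    then show ?thesis
      using homeomorphic_imp_injective_map openin_subset topspace_subtopology_subset by fastforce
  qed
  obtain W s where W: "openin (top_of_set (\<phi> ` U)) W" "w0 \<in> W" and s: "holomorphic_map_on s W"
    and sec: "\<And>w. w \<in> W \<Longrightarrow> s w <#\<^bsub>G\<^esub> H \<in> U \<and> \<phi> (s w <#\<^bsub>G\<^esub> H) = w"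
  proof -
    have "\<forall>p\<in>U. \<exists>W s. openin (top_of_set (\<phi> ` U)) W \<and> \<phi> p \<in> W \<and> holomorphic_map_on s W \<and>
        (\<forall>w\<in>W. s w <#\<^bsub>G\<^esub> H \<in> U \<and> \<phi> (s w <#\<^bsub>G\<^esub> H) = w)"
      using U by (simp add: coset_charts_def)
    from bspec [OF this p(1)] show ?thesis using that p(3) by blast
  qed
  define N where "N = \<phi> ` (U \<inter> V) \<inter> W"
  \<comment> \<open>The local section inverts the chart, so on N the transition map is the
      second chart, read on the group, after the section.\<close>
  have inv: "inv_into U \<phi> w = s w <#\<^bsub>G\<^esub> H" "s w <#\<^bsub>G\<^esub> H \<in> V" if "w \<in> N" for w
  proof -
    have "w \<in> W" using that by (simp add: N_def)
    then show *: "inv_into U \<phi> w = s w <#\<^bsub>G\<^esub> H" using sec inj by (metis inv_into_f_eq)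
    obtain p' where "p' \<in> U" "p' \<in> V" "w = \<phi> p'" using \<open>w \<in> N\<close> by (auto simp: N_def)
    then show "s w <#\<^bsub>G\<^esub> H \<in> V" using * inj by (metis inv_into_f_f)
  qed
  have "w0 \<in> N" using w0 W by (simp add: N_def)
  obtain s' where s': "\<And>c v. s' (c *s v) = c *s s' v" "(s has_derivative s') (at w0 within W)"
    using s W(2) unfolding holomorphic_map_on_def by blast
  have "holomorphic_map_on (\<lambda>x. \<psi> (x <#\<^bsub>G\<^esub> H)) {x. x <#\<^bsub>G\<^esub> H \<in> V}"
    using V by (simp add: coset_charts_def)
  then obtain g' where g': "\<And>c v. g' (c *s v) = c *s g' v"
    "((\<lambda>x. \<psi> (x <#\<^bsub>G\<^esub> H)) has_derivative g') (at (s w0) within {x. x <#\<^bsub>G\<^esub> H \<in> V})"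
    using inv(2) [OF \<open>w0 \<in> N\<close>] unfolding holomorphic_map_on_def by blast
  have "((\<lambda>w. \<psi> (s w <#\<^bsub>G\<^esub> H)) has_derivative (\<lambda>v. g' (s' v))) (at w0 within N)"
  proof (rule has_derivative_in_compose [where f = s and f' = s' and g' = g'
        and g = "\<lambda>x. \<psi> (x <#\<^bsub>G\<^esub> H)"])
    show "(s has_derivative s') (at w0 within N)"
      using s'(2) by (rule has_derivative_subset) (simp add: N_def)
    show "((\<lambda>x. \<psi> (x <#\<^bsub>G\<^esub> H)) has_derivative g') (at (s w0) within s ` N)"
      using g'(2) by (rule has_derivative_subset) (use inv in auto)
  qed
  then have "((\<psi> \<circ> inv_into U \<phi>) has_derivative (\<lambda>v. g' (s' v))) (at w0 within N)"
    by (rule has_derivative_transform [OF \<open>w0 \<in> N\<close>, rotated]) (simp add: inv)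
  moreover have "at w0 within N = at w0 within (\<phi> ` (U \<inter> V))"
  proof -
    obtain O' where "open O'" "W = \<phi> ` U \<inter> O'" using W(1) by (auto simp: openin_open)
    then show ?thesis using \<open>w0 \<in> W\<close>
      by (intro at_within_nhd [of _ O']) (auto simp: N_def)
  qed
  ultimately show "\<exists>f'. (\<forall>c v. f' (c *s v) = c *s f' v) \<and>
      ((\<psi> \<circ> inv_into U \<phi>) has_derivative f') (at w0 within (\<phi> ` (U \<inter> V)))"
    using s'(1) g'(1) by (intro exI [of _ "\<lambda>v. g' (s' v)"]) simp
qed

text \<open>
  \<open>P\<close> stands for the quotient map. Its values lie in the linear subspace \<open>E\<close>, which meets every coset
  in exactly one point, so that \<open>E\<close> serves at once as the range of a global chart and as a global
  section.
\<close>

locale flat_coset_space =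
  fixes G :: "(complex ^ 'm::finite) monoid" and H :: "(complex ^ 'm) set"
    and P :: "complex ^ 'm \<Rightarrow> complex ^ 'm" and E :: "(complex ^ 'm) set"
  assumes carrier: "carrier G = UNIV"
    and fibre: "x <#\<^bsub>G\<^esub> H = P -` {P x}"
    and subspace_E: "vec.subspace E"
    and P_in_E: "P x \<in> E"
    and P_on_E: "w \<in> E \<Longrightarrow> P w = w"
    and holomorphic_P: "holomorphic_map_on P UNIV"
begin

abbreviation "M \<equiv> coset_topology G H"
abbreviation "\<A> \<equiv> coset_charts G H (vec.dim E)"

definition chart :: "(complex ^ 'm) set \<Rightarrow> complex ^ 'm" where
  "chart C = the_elem (P ` C)"

lemma chart_coset [simp]: "chart (x <#\<^bsub>G\<^esub> H) = P x"
proof -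
  have "P ` (x <#\<^bsub>G\<^esub> H) = {P x}" by (auto simp: fibre)
  then show ?thesis by (simp add: chart_def)
qed

lemma topspace_M: "topspace M = range (\<lambda>x. x <#\<^bsub>G\<^esub> H)"
  using carrier by (simp add: lcosets_UNIV)

lemma coset_chart:
  assumes "C \<in> topspace M"
  shows "chart C <#\<^bsub>G\<^esub> H = C"
proof -
  obtain x where x: "C = x <#\<^bsub>G\<^esub> H" using assms by (auto simp: topspace_M)
  have "P x <#\<^bsub>G\<^esub> H = P -` {P (P x)}" by (rule fibre)
  also have "\<dots> = x <#\<^bsub>G\<^esub> H" by (simp only: fibre P_on_E [OF P_in_E])
  finally show ?thesis by (simp add: x)
qed

lemma chart_in_E: "C \<in> topspace M \<Longrightarrow> chart C \<in> E"
  by (auto simp: topspace_M P_in_E)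

lemma coset_in_M [simp]: "x <#\<^bsub>G\<^esub> H \<in> topspace M"
  by (simp add: topspace_M)

lemma continuous_P: "continuous_on UNIV P"
  using holomorphic_P has_derivative_continuous unfolding holomorphic_map_on_def
  by (blast intro: continuous_at_imp_continuous_on)

lemma homeomorphic_maps_chart:
  "homeomorphic_maps M (top_of_set E) chart (\<lambda>w. w <#\<^bsub>G\<^esub> H)"
  unfolding homeomorphic_maps_def
proof (intro conjI ballI)
  show "continuous_map M (top_of_set E) chart"
    unfolding continuous_map_in_subtopology
  proof
    show "continuous_map M euclidean chart"
      unfolding continuous_map_def
    proof (intro conjI allI impI)
      fix U :: "(complex ^ 'm) set" assume "openin euclidean U"
      then have "open (P -` U)" using continuous_P by (simp add: continuous_on_open_vimage)
      moreover have "{x. x <#\<^bsub>G\<^esub> H \<in> {C \<in> topspace M. chart C \<in> U}} = P -` U" by auto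
      ultimately show "openin M {C \<in> topspace M. chart C \<in> U}"
        using carrier by (auto simp: openin_coset_topology)
    qed auto
    show "chart \<in> topspace M \<rightarrow> E" using chart_in_E by auto
  qed
  show "continuous_map (top_of_set E) M (\<lambda>w. w <#\<^bsub>G\<^esub> H)"
    using continuous_map_from_subtopology [OF continuous_map_coset [OF carrier]] .
qed (auto simp: coset_chart P_on_E)

lemma homeomorphic_map_chart: "homeomorphic_map M (top_of_set E) chart"
  using homeomorphic_maps_chart homeomorphic_maps_map by blast

lemma chart_image: "chart ` topspace M = E"
  using homeomorphic_imp_surjective_map [OF homeomorphic_map_chart] by simp

lemma global_chart: "(topspace M, chart) \<in> \<A>"
proof -
  have "complex_chart M (vec.dim E) (topspace M, chart)"
    using homeomorphic_map_chart subspace_E unfolding complex_chart_def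
    by (auto simp: chart_image)
  moreover have "holomorphic_map_on (\<lambda>w. w) E"
    using holomorphic_map_on_translation [of 0] by simp
  ultimately show ?thesis
    using holomorphic_P unfolding coset_charts_def
    by (auto simp: chart_image P_on_E chart_in_E intro!: exI [of _ E] exI [of _ "\<lambda>w. w"])
qed

lemma complex_manifold_M: "complex_manifold M (vec.dim E) \<A>"
  unfolding complex_manifold_def
proof (intro conjI)
  have homeo: "M homeomorphic_space top_of_set E"
    using homeomorphic_map_chart homeomorphic_map_imp_homeomorphic_space by blast
  show "Hausdorff_space M"
    using homeomorphic_Hausdorff_space [OF homeo] by (simp add: Hausdorff_space_subtopology)
  have "second_countable (euclidean :: (complex ^ 'm) topology)"
  proof -
    obtain \<B> :: "(complex ^ 'm) set set" where "countable \<B>" "\<And>C. C \<in> \<B> \<Longrightarrow> open C"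
      and "\<And>S. open S \<Longrightarrow> \<exists>U. U \<subseteq> \<B> \<and> S = \<Union> U"
      using univ_second_countable by blast
    moreover have "\<exists>V\<in>\<B>. x \<in> V \<and> V \<subseteq> U" if "open U" "x \<in> U" for U x
      using calculation(3) [OF that(1)] that(2) by blast
    ultimately show ?thesis unfolding second_countable_def by (intro exI [of _ \<B>]) simp
  qed
  then show "second_countable M"
    using homeomorphic_space_second_countability [OF homeo] by (simp add: second_countable_subtopology)
  show charts: "\<forall>c\<in>\<A>. complex_chart M (vec.dim E) c"
    by (auto simp: coset_charts_def)
  have "fst c \<subseteq> topspace M" if "c \<in> \<A>" for c
    using bspec [OF charts that] by (auto simp: complex_chart_def dest!: openin_subset)
  then show "(\<Union>c\<in>\<A>. fst c) = topspace M"
    using global_chart by force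
  show "\<forall>(U, \<phi>)\<in>\<A>. \<forall>(V, \<psi>)\<in>\<A>. holomorphic_map_on (\<psi> \<circ> inv_into U \<phi>) (\<phi> ` (U \<inter> V))"
    using coset_charts_transition by blast
qed

lemma inv_chart: "w \<in> E \<Longrightarrow> inv_into (topspace M) chart w = w <#\<^bsub>G\<^esub> H"
  using homeomorphic_imp_injective_map [OF homeomorphic_map_chart]
  by (metis P_on_E chart_coset coset_in_M inv_into_f_eq)

text \<open>
  \<open>R\<close> is holomorphy or anti-holomorphy. The congruence rule is required because \<open>f\<close>, read in the chart,
  agrees with \<open>F\<close> on \<open>E\<close> only.
\<close>

lemma locally_in_charts_global:
  assumes f: "f ` topspace M \<subseteq> topspace M" and "\<And>C. C \<in> topspace M \<Longrightarrow> chart (f C) = F (chart C)"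
    and "R F E"
    and cong: "\<And>f g. R f E \<Longrightarrow> (\<And>x. x \<in> E \<Longrightarrow> f x = g x) \<Longrightarrow> R g E"
  shows "locally_in_charts R M \<A> f"
proof -
  have "R (chart \<circ> f \<circ> inv_into (topspace M) chart) E"
    using \<open>R F E\<close> by (rule cong) (simp add: inv_chart assms(2) P_on_E)
  then have "\<exists>(U, \<phi>)\<in>\<A>. \<exists>(V, \<psi>)\<in>\<A>. \<exists>W.
        openin M W \<and> x \<in> W \<and> W \<subseteq> U \<and> f ` W \<subseteq> V \<and> R (\<psi> \<circ> f \<circ> inv_into U \<phi>) (\<phi> ` W)"
    if "x \<in> topspace M" for x
    using f that by (intro bexI [OF _ global_chart] case_prodI exI [of _ "topspace M"])
      (simp add: chart_image)
  then show ?thesis using f by (simp add: locally_in_charts_def)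
qed

end

section \<open>Complexified vectors\<close>

lemma scaleR_complex_vec: "r *\<^sub>R x = complex_of_real r *s x" for x :: "complex ^ 'm"
  by (simp add: vec_eq_iff) (simp add: scaleR_conv_of_real)

lemma linear_complexify: "linear complexify"
  by (auto intro!: linearI simp: complexify_def vec_eq_iff complex_eq_iff)

lemma inj_complexify: "inj complexify"
  by (auto simp: inj_def complexify_def vec_eq_iff)

lemma complexify_0 [simp]: "complexify 0 = 0"
  by (rule linear_0 [OF linear_complexify])

lemma complexify_imaginary_eq [simp]:
  "complexify u + \<i> *s complexify v = complexify u' + \<i> *s complexify v' \<longleftrightarrow> u = u' \<and> v = v'"
  by (auto simp: complexify_def vec_eq_iff complex_eq_iff)

lemma complex_vec_cases:
  obtains u v where "x = complexify u + \<i> *s complexify v"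
proof
  show "x = complexify (\<chi> i. Re (x $ i)) + \<i> *s complexify (\<chi> i. Im (x $ i))"
    by (simp add: complexify_def vec_eq_iff complex_eq_iff)
qed

lemma complexify_in_complexification [simp]:
  assumes "subspace q"
  shows "complexify v \<in> complexification q \<longleftrightarrow> v \<in> q"
    "\<i> *s complexify v \<in> complexification q \<longleftrightarrow> v \<in> q"
proof -
  have *: "complexify a + \<i> *s complexify b \<in> complexification q \<longleftrightarrow> a \<in> q \<and> b \<in> q" for a b
    by (auto simp: complexification_def)
  show "complexify v \<in> complexification q \<longleftrightarrow> v \<in> q"
    using * [of v 0] assms by (simp add: subspace_0)
  show "\<i> *s complexify v \<in> complexification q \<longleftrightarrow> v \<in> q"
    using * [of 0 v] assms by (simp add: subspace_0)
qed

lemma subspace_complexification: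
  assumes "subspace q"
  shows "vec.subspace (complexification q)"
proof (rule vec.subspaceI)
  show "0 \<in> complexification q"
    using complexify_in_complexification(1) [OF assms, of 0] assms by (simp add: subspace_0)
next
  fix x y assume "x \<in> complexification q" "y \<in> complexification q"
  then obtain a b a' b' where ab: "a \<in> q" "b \<in> q" "a' \<in> q" "b' \<in> q"
    "x = complexify a + \<i> *s complexify b" "y = complexify a' + \<i> *s complexify b'"
    by (auto simp: complexification_def)
  then have "x + y = complexify (a + a') + \<i> *s complexify (b + b')"
    by (simp add: complexify_def vec_eq_iff complex_eq_iff)
  then show "x + y \<in> complexification q"
    using ab assms unfolding complexification_def by (blast intro: subspace_add)
next
  fix c x assume "x \<in> complexification q"
  then obtain a b where ab: "a \<in> q" "b \<in> q" "x = complexify a + \<i> *s complexify b"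
    by (auto simp: complexification_def)
  then have "c *s x = complexify (Re c *\<^sub>R a - Im c *\<^sub>R b) + \<i> *s complexify (Im c *\<^sub>R a + Re c *\<^sub>R b)"
    by (simp add: complexify_def vec_eq_iff complex_eq_iff)
  moreover have "Re c *\<^sub>R a - Im c *\<^sub>R b \<in> q" "Im c *\<^sub>R a + Re c *\<^sub>R b \<in> q"
    using ab assms by (auto intro: subspace_add subspace_diff subspace_scale)
  ultimately show "c *s x \<in> complexification q"
    unfolding complexification_def by blast
qed

definition vec_cnj :: "complex ^ 'm \<Rightarrow> complex ^ 'm" where
  "vec_cnj v = (\<chi> i. cnj (v $ i))"

lemma vec_cnj_cnj [simp]: "vec_cnj (vec_cnj v) = v"
  by (simp add: vec_cnj_def vec_eq_iff)

lemma vec_cnj_complexify [simp]: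
  "vec_cnj (complexify u + \<i> *s complexify v) = complexify u - \<i> *s complexify v"
  "vec_cnj (complexify u) = complexify u"
  "vec_cnj (\<i> *s complexify u) = - \<i> *s complexify u"
  by (simp_all add: vec_cnj_def complexify_def vec_eq_iff complex_eq_iff)

lemma vec_cnj_minus: "vec_cnj (- v) = - vec_cnj v"
  by (simp add: vec_cnj_def vec_eq_iff)

lemma antiholomorphic_minus_cnj: "antiholomorphic_map_on (\<lambda>w. - vec_cnj w) S"
  unfolding antiholomorphic_map_on_def
proof
  fix x :: "complex ^ 'a"
  have "linear (\<lambda>w :: complex ^ 'a. - vec_cnj w)"
    by (auto intro!: linearI simp: vec_cnj_def vec_eq_iff complex_eq_iff)
  then have "((\<lambda>w. - vec_cnj w) has_derivative (\<lambda>w. - vec_cnj w)) (at x within S)"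
    by (simp add: bounded_linear_imp_has_derivative linear_conv_bounded_linear)
  then show "\<exists>f'. (\<forall>c v. f' (c *s v) = cnj c *s f' v) \<and>
      ((\<lambda>w. - vec_cnj w) has_derivative f') (at x within S)"
    by (intro exI [of _ "\<lambda>w. - vec_cnj w"]) (simp add: vec_cnj_def vec_eq_iff)
qed

lemma C_k_on_const: "C_k_on k (\<lambda>_. c) S"
  by (induction k arbitrary: c) (auto simp: frechet_derivative_const)

lemma C_infinity_on_id: "C_infinity_on (\<lambda>x. x) S"
proof -
  have "C_k_on k (\<lambda>x. x) S" for k
    by (cases k) (auto simp: frechet_derivative_ident C_k_on_const)
  then show ?thesis by (simp add: C_infinity_on_def)
qed

lemma euclidean_submanifold_subspace:
  fixes K :: "'a::euclidean_space set"
  assumes "subspace K"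
  shows "euclidean_submanifold (dim K) K"
  unfolding euclidean_submanifold_def
proof
  fix x assume "x \<in> K"
  show "\<exists>W W' \<Phi> \<Psi> K'. open W \<and> x \<in> W \<and> open W' \<and> homeomorphism W W' \<Phi> \<Psi> \<and>
      C_infinity_on \<Phi> W \<and> C_infinity_on \<Psi> W' \<and>
      subspace K' \<and> dim K' = dim K \<and> \<Phi> ` (W \<inter> K) = W' \<inter> (K' :: 'a set)"
    by (rule exI [where x = "UNIV :: 'a set"], rule exI [where x = "UNIV :: 'a set"],
        rule exI [where x = "\<lambda>x :: 'a. x"], rule exI [where x = "\<lambda>x :: 'a. x"],
        rule exI [where x = K])
      (use assms in \<open>simp add: homeomorphism_def C_infinity_on_id\<close>)
qed

section \<open>Groups acting by real translations\<close>

text \<open>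
  The elements of \<open>L\<close> become translations by vectors of the real form \<open>q\<close> of \<open>E\<close>, and by
  \<open>p_image\<close> all such translations occur: an orbit is a set \<open>w + q\<close>.
\<close>

locale flat_visible_action = flat_coset_space G H P "complexification q"
  for G :: "(complex ^ 'm::finite) monoid" and H P and q :: "(real ^ 'm) set" +
  fixes L :: "(real ^ 'm) monoid" and p :: "real ^ 'm \<Rightarrow> real ^ 'm"
  assumes group_G: "group G" and group_L: "group L"
    and subgroup_H: "subgroup H G"
    and complexify_one: "complexify \<one>\<^bsub>L\<^esub> = \<one>\<^bsub>G\<^esub>"
    and complexify_mult: "complexify (g \<otimes>\<^bsub>L\<^esub> g') = complexify g \<otimes>\<^bsub>G\<^esub> complexify g'"
    and subspace_q: "subspace q" and linear_p: "linear p" and p_image: "p ` carrier L = q"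
    and P_translate: "g \<in> carrier L \<Longrightarrow> P (complexify g \<otimes>\<^bsub>G\<^esub> x) = complexify (p g) + P x"
begin

abbreviation "act g C \<equiv> complexify g <#\<^bsub>G\<^esub> C"

lemma act_coset: "act g (x <#\<^bsub>G\<^esub> H) = (complexify g \<otimes>\<^bsub>G\<^esub> x) <#\<^bsub>G\<^esub> H"
  using group.lcos_m_assoc [OF group_G] subgroup_H carrier by (simp add: subgroup.subset)

lemma act_in_M: "C \<in> topspace M \<Longrightarrow> act g C \<in> topspace M"
  by (auto simp: topspace_M act_coset)

lemma chart_act:
  assumes "g \<in> carrier L" "C \<in> topspace M"
  shows "chart (act g C) = complexify (p g) + chart C"
  using assms by (auto simp: topspace_M act_coset P_translate)

lemma act_eq:
  assumes "g \<in> carrier L" "C \<in> topspace M"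
  shows "act g C = (complexify (p g) + chart C) <#\<^bsub>G\<^esub> H"
  using coset_chart [OF act_in_M [OF assms(2), of g]] chart_act [OF assms] by simp

lemma group_orbit_eq:
  assumes "C \<in> topspace M"
  shows "group_orbit L act C = (\<lambda>v. (complexify v + chart C) <#\<^bsub>G\<^esub> H) ` q"
  using assms by (auto simp: group_orbit_def act_eq p_image [symmetric])

lemma holomorphic_action_M: "holomorphic_action M \<A> L act"
  unfolding holomorphic_action_def
proof (intro conjI ballI)
  show "group L" by (rule group_L)
next
  fix C assume "C \<in> topspace M"
  then obtain x where "C = x <#\<^bsub>G\<^esub> H" by (auto simp: topspace_M)
  then show "act \<one>\<^bsub>L\<^esub> C = C"
    using monoid.l_one [OF group.is_monoid [OF group_G], of x] carrier
      act_coset [of "\<one>\<^bsub>L\<^esub>" x] by (simp add: complexify_one)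
next
  fix l l' C assume "C \<in> topspace M"
  then obtain x where "C = x <#\<^bsub>G\<^esub> H" by (auto simp: topspace_M)
  then show "act (l \<otimes>\<^bsub>L\<^esub> l') C = act l (act l' C)"
    using monoid.m_assoc [OF group.is_monoid [OF group_G], of "complexify l" "complexify l'" x] carrier
      act_coset [of "l \<otimes>\<^bsub>L\<^esub> l'" x] by (simp add: act_coset complexify_mult)
next
  fix l assume l: "l \<in> carrier L"
  show "holomorphic_self_map M \<A> (act l)"
  proof (rule locally_in_charts_global [where F = "\<lambda>w. complexify (p l) + w"])
    show "act l ` topspace M \<subseteq> topspace M" using act_in_M by auto
    show "\<And>C. C \<in> topspace M \<Longrightarrow> chart (act l C) = complexify (p l) + chart C"
      using chart_act [OF l] .
    show "holomorphic_map_on (\<lambda>w. complexify (p l) + w) (complexification q)"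
      by (rule holomorphic_map_on_translation)
  qed (rule holomorphic_map_on_cong)
next
  let ?X = "prod_topology (top_of_set (carrier L)) M"
  have "linear (\<lambda>l. complexify (p l))"
    using linear_compose [OF linear_p linear_complexify] by (simp add: o_def)
  then have "continuous_on (carrier L) (\<lambda>l. complexify (p l))"
    by (rule linear_continuous_on [OF linear_conv_bounded_linear [THEN iffD1]])
  then have "continuous_map (top_of_set (carrier L)) euclidean (\<lambda>l. complexify (p l))"
    by simp
  from continuous_map_compose [OF continuous_map_fst this]
  have 1: "continuous_map ?X euclidean (\<lambda>z. complexify (p (fst z)))" by (simp add: o_def)
  have "continuous_map M euclidean chart"
    using homeomorphic_maps_chart by (simp add: homeomorphic_maps_def continuous_map_in_subtopology)
  from continuous_map_compose [OF continuous_map_snd this]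
  have 2: "continuous_map ?X euclidean (\<lambda>z. chart (snd z))" by (simp add: o_def)
  have "continuous_map ?X M (\<lambda>z. (complexify (p (fst z)) + chart (snd z)) <#\<^bsub>G\<^esub> H)"
    using continuous_map_compose [OF continuous_map_add [OF 1 2] continuous_map_coset [OF carrier]]
    by (simp add: o_def)
  then show "continuous_map ?X M (\<lambda>(l, C). act l C)"
    by (rule continuous_map_eq) (auto simp: act_eq)
qed

text \<open>
  In the chart the space is \<open>q + iq\<close> and the orbits are the sets \<open>q + iv\<close>, so \<open>iq\<close> meets each of them once,
  and its points are fixed by \<open>w \<mapsto> - cnj w\<close>.
\<close>

definition slice :: "(complex ^ 'm) set set" where
  "slice = (\<lambda>v. (\<i> *s complexify v) <#\<^bsub>G\<^esub> H) ` q"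

definition reflection :: "(complex ^ 'm) set \<Rightarrow> (complex ^ 'm) set" where
  "reflection C = (- vec_cnj (chart C)) <#\<^bsub>G\<^esub> H"

lemma minus_cnj_in_E:
  assumes "w \<in> complexification q"
  shows "- vec_cnj w \<in> complexification q"
proof -
  obtain u v where uv: "u \<in> q" "v \<in> q" "w = complexify u + \<i> *s complexify v"
    using assms by (auto simp: complexification_def)
  have "- vec_cnj w = complexify (- u) + \<i> *s complexify v"
    using uv(3) linear_neg [OF linear_complexify, of u] by simp
  then show ?thesis
    using uv subspace_neg [OF subspace_q] unfolding complexification_def by blast
qed

lemma reflection_in_M: "reflection C \<in> topspace M"
  by (simp add: reflection_def)

lemma chart_reflection: "C \<in> topspace M \<Longrightarrow> chart (reflection C) = - vec_cnj (chart C)"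
  by (simp add: reflection_def P_on_E minus_cnj_in_E chart_in_E)

lemma reflection_reflection: "C \<in> topspace M \<Longrightarrow> reflection (reflection C) = C"
  using chart_reflection [of C] coset_chart
  by (simp add: reflection_def [of "reflection C"] vec_cnj_minus)

lemma antiholomorphic_diffeo_reflection: "antiholomorphic_diffeo M \<A> reflection"
proof -
  have inj: "inj_on reflection (topspace M)"
    by (rule inj_on_inverseI [where g = reflection]) (rule reflection_reflection)
  have bij: "bij_betw reflection (topspace M) (topspace M)"
    by (rule bij_betw_byWitness [where f' = reflection])
      (auto simp: reflection_reflection reflection_in_M)
  have inv: "inv_into (topspace M) reflection C = reflection C" if "C \<in> topspace M" for C
    by (rule inv_into_f_eq [OF inj reflection_in_M]) (simp add: reflection_reflection that)
  have anti: "locally_in_charts antiholomorphic_map_on M \<A> f"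
    if "\<And>C. C \<in> topspace M \<Longrightarrow> f C = reflection C" for f
  proof (rule locally_in_charts_global [where F = "\<lambda>w. - vec_cnj w"])
    show "f ` topspace M \<subseteq> topspace M" using that reflection_in_M by auto
    show "\<And>C. C \<in> topspace M \<Longrightarrow> chart (f C) = - vec_cnj (chart C)"
      using that chart_reflection by simp
    show "antiholomorphic_map_on (\<lambda>w. - vec_cnj w) (complexification q)"
      by (rule antiholomorphic_minus_cnj)
  qed (rule antiholomorphic_map_on_cong)
  show ?thesis
    using bij anti [of reflection] anti [OF inv] by (simp add: antiholomorphic_diffeo_def)
qed

lemma real_submanifold_slice: "real_submanifold M \<A> (dim q) slice"
proof -
  let ?j = "\<lambda>v :: real ^ 'm. \<i> *s complexify v"
  have lin: "linear ?j"
    by (rule linearI)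
      (simp_all add: linear_add [OF linear_complexify] linear_scale [OF linear_complexify]
        vec.scale_right_distrib vec_eq_iff)
  have "inj ?j" using inj_complexify by (auto simp: inj_def)
  then have dim: "dim (?j ` q) = dim q"
    by (intro dim_image_eq [OF lin]) (rule inj_on_subset, auto)
  have sub: "slice \<subseteq> topspace M" by (auto simp: slice_def)
  have "chart ` (slice \<inter> topspace M) = ?j ` q"
    using sub by (auto simp: slice_def image_image P_on_E subspace_q Int_absorb2)
  then have "euclidean_submanifold (dim q) (chart ` (slice \<inter> topspace M))"
    using euclidean_submanifold_subspace [OF linear_subspace_image [OF lin subspace_q]] dim by simp
  then show ?thesis
    using sub global_chart unfolding real_submanifold_def by blast
qed

lemma visible_slice_slice: "visible_slice M \<A> L act (dim q) slice"
proof -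
  have slice_M: "slice \<subseteq> topspace M" by (auto simp: slice_def)
  have orbits: "(\<Union>s\<in>slice. group_orbit L act s) = topspace M"
  proof
    show "(\<Union>s\<in>slice. group_orbit L act s) \<subseteq> topspace M"
      using slice_M by (auto simp: group_orbit_def intro!: act_in_M)
    show "topspace M \<subseteq> (\<Union>s\<in>slice. group_orbit L act s)"
    proof
      fix C assume C: "C \<in> topspace M"
      obtain u v where uv: "u \<in> q" "v \<in> q" "chart C = complexify u + \<i> *s complexify v"
        using chart_in_E [OF C] by (auto simp: complexification_def)
      let ?s = "(\<i> *s complexify v) <#\<^bsub>G\<^esub> H"
      have "chart ?s = \<i> *s complexify v" using uv by (simp add: P_on_E subspace_q)
      then have "C \<in> group_orbit L act ?s"
        using uv coset_chart [OF C] by (auto simp: group_orbit_eq intro!: image_eqI [of _ _ u])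
      then show "C \<in> (\<Union>s\<in>slice. group_orbit L act s)"
        using uv(2) by (auto simp: slice_def)
    qed
  qed
  have fixed: "reflection s = s" if "s \<in> slice" for s
    using that by (auto simp: slice_def reflection_def P_on_E subspace_q)
  \<comment> \<open>In the chart an orbit is a coset of the real form, and w and its reflection differ
      by twice the real part of w.\<close>
  have preserved: "reflection ` group_orbit L act C = group_orbit L act C" if C: "C \<in> topspace M" for C
  proof -
    obtain u v where uv: "u \<in> q" "v \<in> q" "chart C = complexify u + \<i> *s complexify v"
      using chart_in_E [OF C] by (auto simp: complexification_def)
    have "complexify a + chart C \<in> complexification q" if "a \<in> q" for a
      using that vec.subspace_add [OF subspace_E] chart_in_E [OF C] by (simp add: subspace_q)
    then have refl: "reflection ((complexify a + chart C) <#\<^bsub>G\<^esub> H)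
        = (complexify (- a - 2 *\<^sub>R u) + chart C) <#\<^bsub>G\<^esub> H" if "a \<in> q" for a
      using that uv(3)
      by (simp add: reflection_def P_on_E complexify_def vec_cnj_def)
        (rule arg_cong [where f = "\<lambda>x. x <#\<^bsub>G\<^esub> H"], simp add: vec_eq_iff complex_eq_iff)
    have *: "- a - 2 *\<^sub>R u \<in> q" if "a \<in> q" for a
      using that uv by (intro subspace_diff subspace_scale subspace_neg subspace_q)
    have "(\<lambda>a. - a - 2 *\<^sub>R u) ` q = q"
    proof
      show "q \<subseteq> (\<lambda>a. - a - 2 *\<^sub>R u) ` q"
        using * by (intro subsetI image_eqI [of _ _ "- x - 2 *\<^sub>R u" for x]) auto
    qed (use * in auto)
    then have "(\<lambda>a. (complexify a + chart C) <#\<^bsub>G\<^esub> H) ` (\<lambda>a. - a - 2 *\<^sub>R u) ` q = group_orbit L act C"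
      by (simp add: group_orbit_eq [OF C])
    then show ?thesis
      by (simp add: group_orbit_eq [OF C] image_image refl cong: image_cong_simp)
  qed
  have "topspace M \<noteq> {}" using coset_in_M by blast
  then show ?thesis
    unfolding visible_slice_def Let_def orbits
    using real_submanifold_slice antiholomorphic_diffeo_reflection fixed preserved by blast
qed

lemma connected_space_M: "connected_space M"
proof -
  have "convex (complexification q)"
    using subspace_E unfolding vec.subspace_def convex_def by (simp add: scaleR_complex_vec)
  then have "connected_space (top_of_set (complexification q))"
    by (simp add: connected_space_subtopology convex_connected)
  then show ?thesis
    using homeomorphic_connected_space homeomorphic_map_chart homeomorphic_map_imp_homeomorphic_space
    by blast
qed

theorem strongly_visible_M: "strongly_visible M (vec.dim (complexification q)) \<A> L act"
  unfolding strongly_visible_def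
  using complex_manifold_M connected_space_M holomorphic_action_M visible_slice_slice by blast

end

section \<open>Right translations and the failure of multiplicity-freeness\<close>

text \<open>
  Let the time \<open>c\<close> be constant along the flow \<open>\<tau>\<close>. If \<open>c\<close> takes countably many values, the map
  \<open>x \<mapsto> \<tau> (c x) x\<close> preserves the measure, since it respects the level sets of \<open>c\<close> and acts on each of
  them as a single \<open>\<tau> s\<close>. In general \<open>c\<close> is the limit of the functions \<open>\<lfloor>k c\<rfloor> / k\<close>, and a point
  that is carried into \<open>U\<close> in time \<open>c x\<close> is carried into \<open>U\<close> in all nearby times. An inequality
  is enough because it will be used for the inverse map as well.
\<close>

lemma emeasure_flow_vimage_le:
  fixes \<tau> :: "real \<Rightarrow> 'a \<Rightarrow> 'a" and c :: "'a \<Rightarrow> real"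
  assumes \<tau>: "\<And>s. \<tau> s \<in> measurable M M"
    and invariant: "\<And>s A. A \<in> sets M \<Longrightarrow> emeasure M (\<tau> s -` A \<inter> space M) = emeasure M A"
    and c: "c \<in> borel_measurable M" and c_\<tau>: "\<And>s x. x \<in> space M \<Longrightarrow> c (\<tau> s x) = c x"
    and U: "U \<in> sets M" and open_U: "\<And>x. x \<in> space M \<Longrightarrow> open {s. \<tau> s x \<in> U}"
    and V: "{x \<in> space M. \<tau> (c x) x \<in> U} \<in> sets M"
  shows "emeasure M {x \<in> space M. \<tau> (c x) x \<in> U} \<le> emeasure M U"
proof -
  \<comment> \<open>The denominators are Suc k, so they never vanish.\<close>
  define N where "N k j = {x \<in> space M. \<lfloor>real (Suc k) * c x\<rfloor> = j}" for k :: nat and j :: int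
  define A where "A k = {x \<in> space M. \<tau> (of_int \<lfloor>real (Suc k) * c x\<rfloor> / real (Suc k)) x \<in> U}" for k
  have N [measurable]: "N k j \<in> sets M" for k j
    unfolding N_def using c by measurable
  have UN: "U = (\<Union>j. U \<inter> N k j)" "disjoint_family (\<lambda>j. U \<inter> N k j)" for k
    using sets.sets_into_space [OF U] by (auto simp: N_def disjoint_family_on_def)
  have A_eq: "A k = (\<Union>j. \<tau> (of_int j / real (Suc k)) -` (U \<inter> N k j) \<inter> space M)" for k
    using measurable_space [OF \<tau>] by (auto simp: A_def N_def c_\<tau>)
  have sets_piece: "\<tau> (of_int j / real (Suc k)) -` (U \<inter> N k j) \<inter> space M \<in> sets M" for k j
    using measurable_sets [OF \<tau>] U N by blast
  then have sets_A: "A k \<in> sets M" for k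
    unfolding A_eq by blast
  have emeasure_A: "emeasure M (A k) = emeasure M U" for k
  proof -
    have "emeasure M (A k) =
        (\<integral>\<^sup>+j. emeasure M (\<tau> (of_int j / real (Suc k)) -` (U \<inter> N k j) \<inter> space M) \<partial>count_space UNIV)"
      unfolding A_eq
    proof (rule emeasure_UN_countable)
      show "disjoint_family (\<lambda>j. \<tau> (of_int j / real (Suc k)) -` (U \<inter> N k j) \<inter> space M)"
        by (auto simp: disjoint_family_on_def N_def c_\<tau>)
    qed (use sets_piece in auto)
    also have "\<dots> = (\<integral>\<^sup>+j. emeasure M (U \<inter> N k j) \<partial>count_space UNIV)"
      using U N by (intro nn_integral_cong invariant) auto
    also have "\<dots> = emeasure M (\<Union>j. U \<inter> N k j)"
      by (rule emeasure_UN_countable [symmetric]) (use U UN(2) in auto)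
    also have "\<dots> = emeasure M U"
      by (simp only: UN(1) [symmetric])
    finally show ?thesis .
  qed
  have "{x \<in> space M. \<tau> (c x) x \<in> U} \<subseteq> (\<Union>m. \<Inter>k\<in>{m..}. A k)"
  proof safe
    fix x assume x: "x \<in> space M" "\<tau> (c x) x \<in> U"
    have "(\<lambda>k. of_int \<lfloor>real (Suc k) * c x\<rfloor> / real (Suc k)) \<longlonglongrightarrow> c x"
    proof (rule LIMSEQ_I)
      fix r :: real assume "r > 0"
      then obtain n0 where n0: "inverse (real (Suc n0)) < r" using reals_Archimedean by blast
      have "norm (of_int \<lfloor>real (Suc k) * c x\<rfloor> / real (Suc k) - c x) < r" if "k \<ge> n0" for k
      proof -
        have "of_int \<lfloor>real (Suc k) * c x\<rfloor> / real (Suc k) - c x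
            = (of_int \<lfloor>real (Suc k) * c x\<rfloor> - real (Suc k) * c x) / real (Suc k)"
          by (simp add: diff_divide_distrib del: of_nat_Suc)
        moreover have "\<bar>of_int \<lfloor>real (Suc k) * c x\<rfloor> - real (Suc k) * c x\<bar> \<le> 1"
          by linarith
        ultimately have "\<bar>of_int \<lfloor>real (Suc k) * c x\<rfloor> / real (Suc k) - c x\<bar> \<le> inverse (real (Suc k))"
          by (simp add: inverse_eq_divide divide_right_mono del: of_nat_Suc)
        also have "\<dots> \<le> inverse (real (Suc n0))" using that by simp
        finally show ?thesis using n0 by simp
      qed
      then show "\<exists>no. \<forall>n\<ge>no. norm (of_int \<lfloor>real (Suc n) * c x\<rfloor> / real (Suc n) - c x) < r"
        by blast
    qed
    from topological_tendstoD [OF this open_U [OF x(1)]] x(2)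
    have "\<forall>\<^sub>F k in sequentially. x \<in> A k"
      using x(1) by (simp add: A_def)
    then show "x \<in> (\<Union>m. \<Inter>k\<in>{m..}. A k)"
      by (auto simp: eventually_sequentially)
  qed
  then have "emeasure M {x \<in> space M. \<tau> (c x) x \<in> U} \<le> emeasure M (\<Union>m. \<Inter>k\<in>{m..}. A k)"
    using sets_A by (intro emeasure_mono) (auto intro!: sets.countable_INT'')
  also have "\<dots> = (SUP m. emeasure M (\<Inter>k\<in>{m..}. A k))"
    using sets_A
    by (intro SUP_emeasure_incseq [symmetric])
      (auto simp: incseq_def intro!: sets.countable_INT')
  also have "\<dots> \<le> emeasure M U"
  proof (rule SUP_least)
    fix m :: nat
    have "emeasure M (\<Inter>k\<in>{m..}. A k) \<le> emeasure M (A m)"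
      using sets_A by (intro emeasure_mono) auto
    then show "emeasure M (\<Inter>k\<in>{m..}. A k) \<le> emeasure M U" by (simp add: emeasure_A)
  qed
  finally show ?thesis .
qed

lemma bounded_bilinear_heis_bracket:
  "bounded_bilinear (heis_bracket :: (real, 'n::finite) heis \<Rightarrow> _)"
  "bounded_bilinear (heis_bracket :: (complex, 'n::finite) heis \<Rightarrow> _)"
proof -
  have "heis_bracket (r *\<^sub>R u) v = r *\<^sub>R heis_bracket u v" "heis_bracket u (r *\<^sub>R v) = r *\<^sub>R heis_bracket u v"
    for r and u v :: "(complex, 'n) heis"
    using heis_bracket_scale_left [of "complex_of_real r" u v]
      heis_bracket_scale_right [of u "complex_of_real r" v]
    by (simp_all add: scaleR_complex_vec)
  then have "bilinear (heis_bracket :: (complex, 'n) heis \<Rightarrow> _)"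
    by (auto simp: bilinear_def heis_bracket_bilinear intro!: linearI)
  moreover have "bilinear (heis_bracket :: (real, 'n) heis \<Rightarrow> _)"
    by (auto simp: bilinear_def heis_bracket_bilinear heis_bracket_scaleR intro!: linearI)
  ultimately show "bounded_bilinear (heis_bracket :: (real, 'n) heis \<Rightarrow> _)"
    "bounded_bilinear (heis_bracket :: (complex, 'n) heis \<Rightarrow> _)"
    by (simp_all add: bilinear_conv_bounded_bilinear)
qed

lemmas continuous_heis_bracket [continuous_intros] =
  bounded_bilinear.continuous_on [OF bounded_bilinear_heis_bracket(1)]

locale invariant_coset_measure =
  fixes h :: "(real, 'n::finite) heis set" and \<mu> :: "(real, 'n) heis set measure"
  assumes lie: "lie_subalgebra h" and invariant: "invariant_measure heis_group h \<mu>"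
begin

abbreviation "G \<equiv> heis_group :: (real, 'n) heis monoid"
abbreviation "M \<equiv> coset_topology G h"
abbreviation "coset x \<equiv> x <#\<^bsub>G\<^esub> h"

lemma subspace_h: "subspace h" and bracket_h: "u \<in> h \<Longrightarrow> v \<in> h \<Longrightarrow> heis_bracket u v \<in> h"
  using lie by (auto simp: lie_subalgebra_def)

lemma mult_in_h: "u \<in> h \<Longrightarrow> v \<in> h \<Longrightarrow> u \<otimes>\<^bsub>G\<^esub> v \<in> h"
  by (auto simp: mult_heis_group scalar_mult_eq_scaleR
      intro!: subspace_add subspace_scale subspace_h bracket_h)

lemma subgroup_h: "subgroup h G"
  by (rule subgroup.intro) (auto simp: mult_in_h subspace_0 subspace_h subspace_neg)

lemma coset_eq_iff: "coset x = coset y \<longleftrightarrow> y - x - (1/2) *s heis_bracket x y \<in> h"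
proof -
  have "coset x = coset y \<longleftrightarrow> y \<in> coset x"
    using group.lcos_self [OF group_heis_group _ subgroup_h]
      group.l_repr_independence [OF group_heis_group _ _ subgroup_h] by fastforce
  also have "\<dots> \<longleftrightarrow> - x \<otimes>\<^bsub>G\<^esub> y \<in> h"
    using subgroup.lcos_module_imp [OF subgroup_h group_heis_group, of x y]
      subgroup.lcos_module_rev [OF subgroup_h group_heis_group, of x y] by auto
  finally show ?thesis by (simp add: mult_heis_group heis_bracket_minus_left algebra_simps)
qed

lemma translate_coset: "g <#\<^bsub>G\<^esub> coset x = coset (g \<otimes>\<^bsub>G\<^esub> x)"
  using group.lcos_m_assoc [OF group_heis_group, of h g x] by simp

lemma space_\<mu>: "space \<mu> = range coset"
  using invariant by (simp add: invariant_measure_def lcosets_UNIV)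

lemma sets_\<mu>: "sets \<mu> = sigma_sets (space \<mu>) {U. openin M U}"
  using invariant by (simp add: invariant_measure_def)

lemma openin_M: "openin M U \<longleftrightarrow> U \<subseteq> space \<mu> \<and> open {x. coset x \<in> U}"
  by (simp add: openin_coset_topology lcosets_UNIV space_\<mu>)

lemma coset_in_space [simp]: "coset x \<in> space \<mu>"
  by (simp add: space_\<mu>)

lemma openin_sets: "openin M U \<Longrightarrow> U \<in> sets \<mu>"
  by (auto simp: sets_\<mu>)

text \<open>
  Maps of the coset space are studied through continuous lifts to the group; their continuity and
  measurability follow because the quotient topology is the one induced by the group.
\<close>

lemma openin_vimage:
  assumes "\<And>x. f (coset x) = coset (F x)" and "continuous_on UNIV F" and "openin M U"
  shows "openin M (f -` U \<inter> space \<mu>)"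
proof -
  have "{x. coset x \<in> f -` U \<inter> space \<mu>} = F -` {x. coset x \<in> U}" using assms(1) by auto
  moreover have "open (F -` {x. coset x \<in> U})"
    using assms(2,3) by (intro open_vimage) (simp_all add: openin_M)
  ultimately show ?thesis by (simp add: openin_M)
qed

lemma measurable_lift:
  assumes "\<And>x. f (coset x) = coset (F x)" and "continuous_on UNIV F"
  shows "f \<in> measurable \<mu> \<mu>"
proof (rule measurable_sigma_sets [OF sets_\<mu>])
  show "{U. openin M U} \<subseteq> Pow (space \<mu>)" by (auto simp: openin_M)
  show "f \<in> space \<mu> \<rightarrow> space \<mu>" using assms(1) by (auto simp: space_\<mu>)
  show "f -` U \<inter> space \<mu> \<in> sets \<mu>" if "U \<in> {U. openin M U}" for U
    using openin_vimage [OF assms] that openin_sets by auto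
qed

lemma borel_measurable_lift:
  fixes f :: "(real, 'n) heis set \<Rightarrow> real"
  assumes "\<And>x. f (coset x) = F x" and "continuous_on UNIV F"
  shows "f \<in> borel_measurable \<mu>"
proof (rule borel_measurableI)
  fix S :: "real set" assume "open S"
  then have "open (F -` S)" using assms(2) by (simp add: continuous_on_open_vimage)
  moreover have "{x. coset x \<in> f -` S \<inter> space \<mu>} = F -` S" using assms(1) by auto
  ultimately show "f -` S \<inter> space \<mu> \<in> sets \<mu>"
    by (intro openin_sets) (simp add: openin_M)
qed

lemma continuous_mult: "continuous_on UNIV (\<lambda>x. g \<otimes>\<^bsub>G\<^esub> x)" "continuous_on UNIV (\<lambda>x. x \<otimes>\<^bsub>G\<^esub> g)"
  by (auto simp: mult_heis_group scalar_mult_eq_scaleR intro!: continuous_intros)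

lemma translate_inv:
  assumes "C \<in> space \<mu>"
  shows "g <#\<^bsub>G\<^esub> ((- g) <#\<^bsub>G\<^esub> C) = C"
proof -
  obtain x where x: "C = coset x" using assms by (auto simp: space_\<mu>)
  have "g \<otimes>\<^bsub>G\<^esub> (- g \<otimes>\<^bsub>G\<^esub> x) = x" by (simp add: mult_heis_group heis_bracket_bilinear)
  then show ?thesis unfolding x translate_coset by simp
qed

lemma emeasure_translate_vimage:
  assumes "A \<in> sets \<mu>"
  shows "emeasure \<mu> ((\<lambda>C. g <#\<^bsub>G\<^esub> C) -` A \<inter> space \<mu>) = emeasure \<mu> A"
proof -
  have "(\<lambda>C. g <#\<^bsub>G\<^esub> C) -` A \<inter> space \<mu> = (\<lambda>C. (- g) <#\<^bsub>G\<^esub> C) ` A"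
  proof
    show "(\<lambda>C. g <#\<^bsub>G\<^esub> C) -` A \<inter> space \<mu> \<subseteq> (\<lambda>C. (- g) <#\<^bsub>G\<^esub> C) ` A"
      using translate_inv [of _ "- g"] by (force intro!: image_eqI)
    show "(\<lambda>C. (- g) <#\<^bsub>G\<^esub> C) ` A \<subseteq> (\<lambda>C. g <#\<^bsub>G\<^esub> C) -` A \<inter> space \<mu>"
      using translate_inv [of _ g] sets.sets_into_space [OF assms]
      by (auto simp: space_\<mu> translate_coset subset_iff)
  qed
  then show ?thesis using invariant assms by (simp add: invariant_measure_def)
qed

text \<open>
  These sets exhaust the coset space by open sets of finite measure.
\<close>

definition ball_image :: "nat \<Rightarrow> (real, 'n) heis set set" where
  "ball_image k = coset ` ball 0 (real k)"

lemma openin_ball_image: "openin M (ball_image k)"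
proof -
  have "{x. coset x \<in> ball_image k} = (\<Union>u\<in>h. (\<lambda>x. x \<otimes>\<^bsub>G\<^esub> u) -` ball 0 (real k))"
  proof (intro equalityI subsetI)
    fix x assume "x \<in> {x. coset x \<in> ball_image k}"
    then obtain w where w: "w \<in> ball 0 (real k)" "coset x = coset w" by (auto simp: ball_image_def)
    then have "w \<in> coset x" using group.lcos_self [OF group_heis_group _ subgroup_h] by simp
    then show "x \<in> (\<Union>u\<in>h. (\<lambda>x. x \<otimes>\<^bsub>G\<^esub> u) -` ball 0 (real k))"
      using w(1) by (auto simp: l_coset_def)
  next
    fix x assume "x \<in> (\<Union>u\<in>h. (\<lambda>x. x \<otimes>\<^bsub>G\<^esub> u) -` ball 0 (real k))"
    then obtain u where u: "u \<in> h" "x \<otimes>\<^bsub>G\<^esub> u \<in> ball 0 (real k)" by auto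
    have "x \<otimes>\<^bsub>G\<^esub> u \<in> coset x" using u(1) by (auto simp: l_coset_def)
    then have "coset x = coset (x \<otimes>\<^bsub>G\<^esub> u)"
      by (rule group.l_repr_independence [OF group_heis_group _ _ subgroup_h]) simp
    then show "x \<in> {x. coset x \<in> ball_image k}" using u(2) by (auto simp: ball_image_def)
  qed
  moreover have "open \<dots>"
    using continuous_mult(2) by (auto simp: continuous_on_open_vimage)
  ultimately show ?thesis by (auto simp: openin_M ball_image_def)
qed

text \<open>
  The image of the closed ball is compact and hence of finite measure. To pass to a subset one
  needs it to be measurable, and it is in fact closed: its preimage in the group is the projection
  of a closed set along a compact one.
\<close>

lemma emeasure_ball_image_finite: "emeasure \<mu> (ball_image k) < \<infinity>"
proof -
  have "compactin M (coset ` cball 0 (real k))"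
    using image_compactin [of euclidean "cball 0 (real k)" M coset] continuous_map_coset [of G h] by simp
  then have finite: "emeasure \<mu> (coset ` cball 0 (real k)) < \<infinity>"
    using invariant by (simp add: invariant_measure_def)
  let ?T = "{z. snd z - fst z - (1/2) *s heis_bracket (fst z) (snd z) \<in> h}"
  have "{x. coset x \<in> coset ` cball 0 (real k)} = {x. \<exists>w. w \<in> cball 0 (real k) \<and> (w, x) \<in> ?T}"
  proof -
    have "coset x \<in> coset ` cball 0 (real k) \<longleftrightarrow> (\<exists>w. w \<in> cball 0 (real k) \<and> coset w = coset x)" for x
      unfolding image_iff by (auto simp only: bex_simps)
    then show ?thesis by (simp only: coset_eq_iff mem_Collect_eq fst_conv snd_conv)
  qed
  moreover have "closed \<dots>"
  proof (rule closed_compact_projection)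
    have "continuous_on UNIV
        (\<lambda>z :: (real, 'n) heis \<times> (real, 'n) heis. snd z - fst z - (1/2) *s heis_bracket (fst z) (snd z))"
      by (auto simp: scalar_mult_eq_scaleR intro!: continuous_intros)
    from closed_vimage [OF closed_subspace [OF subspace_h] this]
    show "closed ?T" by (simp add: vimage_def)
  qed simp
  ultimately have "open {x. coset x \<in> space \<mu> - coset ` cball 0 (real k)}"
    by (simp add: open_closed Compl_eq)
  then have "openin M (space \<mu> - coset ` cball 0 (real k))"
    by (simp add: openin_M)
  then have "space \<mu> - (space \<mu> - coset ` cball 0 (real k)) \<in> sets \<mu>"
    using openin_sets by blast
  moreover have "space \<mu> - (space \<mu> - coset ` cball 0 (real k)) = coset ` cball 0 (real k)"
    by auto
  ultimately have "coset ` cball 0 (real k) \<in> sets \<mu>" by simp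
  then have "emeasure \<mu> (ball_image k) \<le> emeasure \<mu> (coset ` cball 0 (real k))"
    by (intro emeasure_mono) (auto simp: ball_image_def)
  then show ?thesis using finite by simp
qed

lemma range_ball_image: "(\<Union>k. ball_image k) = space \<mu>"
proof -
  have "\<exists>k. coset x \<in> ball_image k" for x
  proof -
    obtain k where "norm x < real k" using reals_Archimedean2 by blast
    then have "x \<in> ball 0 (real k)" by (simp add: dist_norm)
    then show ?thesis unfolding ball_image_def by blast
  qed
  then show ?thesis by (auto simp: space_\<mu> ball_image_def)
qed

text \<open>
  Multiplication from the right acts on left cosets when the multiplier commutes with \<open>h\<close>.
\<close>

definition right_translate :: "(real, 'n) heis \<Rightarrow> (real, 'n) heis set \<Rightarrow> (real, 'n) heis set" where
  "right_translate a C = (\<lambda>x. x \<otimes>\<^bsub>G\<^esub> a) ` C"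

definition centralizes_h :: "(real, 'n) heis \<Rightarrow> bool" where
  "centralizes_h a \<longleftrightarrow> (\<forall>u\<in>h. heis_bracket u a = 0)"

lemma right_translate_coset:
  assumes "centralizes_h a"
  shows "right_translate a (coset x) = coset (x \<otimes>\<^bsub>G\<^esub> a)"
proof -
  have "(x \<otimes>\<^bsub>G\<^esub> u) \<otimes>\<^bsub>G\<^esub> a = (x \<otimes>\<^bsub>G\<^esub> a) \<otimes>\<^bsub>G\<^esub> u" if "u \<in> h" for u
    using that assms heis_bracket_skew [of a u]
    by (simp add: mult_heis_group heis_bracket_bilinear centralizes_h_def vec.scale_right_distrib)
  then show ?thesis
    by (auto simp: right_translate_def l_coset_def image_iff)
qed

lemma measurable_right_translate: "centralizes_h a \<Longrightarrow> right_translate a \<in> measurable \<mu> \<mu>"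
  by (rule measurable_lift [OF right_translate_coset continuous_mult(2)])

definition central_flow :: "real \<Rightarrow> (real, 'n) heis set \<Rightarrow> (real, 'n) heis set" where
  "central_flow s C = (s *\<^sub>R heis_center) <#\<^bsub>G\<^esub> C"

lemma central_flow_coset: "central_flow s (coset x) = coset (x + s *\<^sub>R heis_center)"
  by (simp add: central_flow_def translate_coset mult_heis_group heis_bracket_scaleR add.commute)

text \<open>
  As \<open>x \<otimes> a = a \<otimes> (x + [x, a])\<close> with \<open>[x, a]\<close> central, right translation by \<open>a\<close> is left
  translation by \<open>a\<close> after the central flow for the time \<open>[x, a]\<close>. This time depends only on the
  coset of \<open>x\<close>, since \<open>a\<close> commutes with \<open>h\<close>, and the flow does not change it.
\<close>

lemma emeasure_right_translate_le:
  assumes a: "centralizes_h a" and U: "openin M U"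
  shows "emeasure \<mu> (right_translate a -` U \<inter> space \<mu>) \<le> emeasure \<mu> U"
proof -
  define c where "c C = heis_bracket (SOME x. x \<in> C) a $ Inr (Inr ())" for C
  have c: "c (coset x) = heis_bracket x a $ Inr (Inr ())" for x
  proof -
    have "(SOME y. y \<in> coset x) \<in> coset x"
      by (rule someI [of _ x]) (simp add: group.lcos_self [OF group_heis_group _ subgroup_h])
    then obtain u where "u \<in> h" "(SOME y. y \<in> coset x) = x \<otimes>\<^bsub>G\<^esub> u" by (auto simp: l_coset_def)
    then show ?thesis
      using a by (simp add: c_def mult_heis_group heis_bracket_bilinear centralizes_h_def)
  qed
  define U' where "U' = (\<lambda>C. a <#\<^bsub>G\<^esub> C) -` U \<inter> space \<mu>"
  have U': "openin M U'" "emeasure \<mu> U' = emeasure \<mu> U"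
    unfolding U'_def
    using openin_vimage [OF translate_coset continuous_mult(1) U] emeasure_translate_vimage [OF openin_sets [OF U]]
    by auto
  have bracket: "heis_bracket x y = (heis_bracket x y $ Inr (Inr ())) *\<^sub>R heis_center"
    for x y :: "(real, 'n) heis"
    by (simp add: heis_bracket_def heis_center_def axis_def vec_eq_iff split: sum.split)
  have "a \<otimes>\<^bsub>G\<^esub> (x + heis_bracket x a) = x \<otimes>\<^bsub>G\<^esub> a" for x
    by (simp add: mult_heis_group heis_bracket_bilinear heis_bracket_skew [of a x] vec_eq_iff)
  then have "right_translate a (coset x) = a <#\<^bsub>G\<^esub> central_flow (c (coset x)) (coset x)" for x
    by (simp add: right_translate_coset [OF a] central_flow_coset c translate_coset flip: bracket)
  then have eq: "right_translate a -` U \<inter> space \<mu> = {C \<in> space \<mu>. central_flow (c C) C \<in> U'}"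
    by (auto simp: space_\<mu> U'_def central_flow_coset)
  have "emeasure \<mu> {C \<in> space \<mu>. central_flow (c C) C \<in> U'} \<le> emeasure \<mu> U'"
  proof (rule emeasure_flow_vimage_le)
    show "central_flow s \<in> measurable \<mu> \<mu>" for s
      by (rule measurable_lift [where F = "\<lambda>x. x + s *\<^sub>R heis_center", OF central_flow_coset]) (intro continuous_intros)
    show "emeasure \<mu> (central_flow s -` A \<inter> space \<mu>) = emeasure \<mu> A" if "A \<in> sets \<mu>" for s A
      using emeasure_translate_vimage [OF that] by (simp add: central_flow_def [abs_def])
    show "c \<in> borel_measurable \<mu>"
      by (rule borel_measurable_lift [where F = "\<lambda>x. heis_bracket x a $ Inr (Inr ())", OF c]) (intro continuous_intros)
    show "c (central_flow s C) = c C" if "C \<in> space \<mu>" for s C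
      using that by (auto simp: space_\<mu> central_flow_coset c heis_bracket_bilinear heis_bracket_scaleR)
    show "U' \<in> sets \<mu>" using U' openin_sets by blast
    show "open {s. central_flow s C \<in> U'}" if C: "C \<in> space \<mu>" for C
    proof -
      obtain x where x: "C = coset x" using C by (auto simp: space_\<mu>)
      have "continuous_on UNIV (\<lambda>s. x + s *\<^sub>R heis_center)" by (intro continuous_intros)
      then have "open ((\<lambda>s. x + s *\<^sub>R heis_center) -` {y. coset y \<in> U'})"
        using U'(1) by (intro open_vimage) (simp_all add: openin_M)
      then show ?thesis by (simp add: x central_flow_coset vimage_def)
    qed
    show "{C \<in> space \<mu>. central_flow (c C) C \<in> U'} \<in> sets \<mu>"
      using measurable_sets [OF measurable_right_translate [OF a] openin_sets [OF U]] by (simp add: eq)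
  qed
  then show ?thesis by (simp add: eq U'(2))
qed

text \<open>
  The inequality for \<open>- a\<close> is the reverse of the one for \<open>a\<close>, so both measures agree on open sets.
\<close>

lemma distr_right_translate:
  assumes a: "centralizes_h a"
  shows "distr \<mu> \<mu> (right_translate a) = \<mu>"
proof (rule measure_eqI_generator_eq)
  show "Int_stable {U. openin M U}" by (auto simp: Int_stable_def)
  show "{U. openin M U} \<subseteq> Pow (space \<mu>)" by (auto simp: openin_M)
  have minus_a: "centralizes_h (- a)" using a by (simp add: centralizes_h_def heis_bracket_bilinear)
  fix U assume "U \<in> {U. openin M U}"
  then have U: "openin M U" by simp
  let ?r = "right_translate a" and ?r' = "right_translate (- a)"
  have V: "openin M (?r -` U \<inter> space \<mu>)"
    by (rule openin_vimage [OF right_translate_coset [OF a] continuous_mult(2) U])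
  have "(x \<otimes>\<^bsub>G\<^esub> - a) \<otimes>\<^bsub>G\<^esub> a = x" for x
    by (simp add: mult_heis_group heis_bracket_bilinear)
  then have "?r (?r' C) = C" if "C \<in> space \<mu>" for C
    using that by (auto simp: space_\<mu> right_translate_coset a minus_a)
  moreover have "?r' C \<in> space \<mu>" if "C \<in> space \<mu>" for C
    using that by (auto simp: space_\<mu> right_translate_coset minus_a)
  moreover have "U \<subseteq> space \<mu>" using U by (simp add: openin_M)
  ultimately have "U = ?r' -` (?r -` U \<inter> space \<mu>) \<inter> space \<mu>" by auto
  then have "emeasure \<mu> U \<le> emeasure \<mu> (?r -` U \<inter> space \<mu>)"
    using emeasure_right_translate_le [OF minus_a V] by simp
  then have "emeasure \<mu> (?r -` U \<inter> space \<mu>) = emeasure \<mu> U"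
    using emeasure_right_translate_le [OF a U] by simp
  then show "emeasure (distr \<mu> \<mu> ?r) U = emeasure \<mu> U"
    by (simp add: emeasure_distr measurable_right_translate [OF a] openin_sets [OF U])
next
  have "ball_image k \<in> sets \<mu>" for k using openin_ball_image openin_sets by blast
  then show "emeasure (distr \<mu> \<mu> (right_translate a)) (ball_image k) \<noteq> \<infinity>" for k
    using emeasure_right_translate_le [OF a openin_ball_image, of k] emeasure_ball_image_finite [of k]
    by (auto simp: emeasure_distr measurable_right_translate [OF a] top_unique)
  show "range ball_image \<subseteq> {U. openin M U}" using openin_ball_image by auto
  show "(\<Union>k. ball_image k) = space \<mu>" by (rule range_ball_image)
  show "sets \<mu> = sigma_sets (space \<mu>) {U. openin M U}" by (rule sets_\<mu>)
  then show "sets (distr \<mu> \<mu> (right_translate a)) = sigma_sets (space \<mu>) {U. openin M U}"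
    by (simp only: sets_distr)
qed

lemma intertwining_right_translate:
  assumes a: "centralizes_h a"
  shows "intertwining_endomorphism G \<mu> (quasi_regular G) (\<lambda>f C. f (right_translate a C))"
proof -
  note meas = measurable_right_translate [OF a]
  have L2: "(\<lambda>C. f (right_translate a C)) \<in> L2_functions \<mu>"
    and norm: "(\<integral>C. (cmod (f (right_translate a C)))\<^sup>2 \<partial>\<mu>) = (\<integral>C. (cmod (f C))\<^sup>2 \<partial>\<mu>)"
    if "f \<in> L2_functions \<mu>" for f
  proof -
    have f: "f \<in> borel_measurable \<mu>" and int: "integrable \<mu> (\<lambda>C. (cmod (f C))\<^sup>2)"
      using that unfolding L2_functions_def by blast+
    have f2: "(\<lambda>C. (cmod (f C))\<^sup>2) \<in> borel_measurable \<mu>" using f by measurable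
    have "integrable (distr \<mu> \<mu> (right_translate a)) (\<lambda>C. (cmod (f C))\<^sup>2)"
      using int by (simp only: distr_right_translate [OF a])
    then have "integrable \<mu> (\<lambda>C. (cmod (f (right_translate a C)))\<^sup>2)"
      by (rule iffD1 [OF integrable_distr_eq [OF meas f2]])
    moreover have "(\<lambda>C. f (right_translate a C)) \<in> borel_measurable \<mu>"
      by (rule measurable_compose [OF meas f])
    ultimately show "(\<lambda>C. f (right_translate a C)) \<in> L2_functions \<mu>"
      unfolding L2_functions_def by blast
    show "(\<integral>C. (cmod (f (right_translate a C)))\<^sup>2 \<partial>\<mu>) = (\<integral>C. (cmod (f C))\<^sup>2 \<partial>\<mu>)"
      using integral_distr [OF meas f2] by (simp only: distr_right_translate [OF a])
  qed
  have "right_translate a (g <#\<^bsub>G\<^esub> C) = g <#\<^bsub>G\<^esub> right_translate a C" if "C \<in> space \<mu>" for g C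
    using that by (auto simp: space_\<mu> translate_coset right_translate_coset [OF a]
        monoid.m_assoc [OF group.is_monoid [OF group_heis_group]])
  then show ?thesis
    unfolding intertwining_endomorphism_def bounded_L2_operator_def
    using L2 norm by (auto simp: quasi_regular_def intro!: AE_I2 exI [of _ 1])
qed

text \<open>
  A linear functional that vanishes on \<open>h\<close> but not at \<open>z\<close> is bounded on the differences that two
  points of the ball can produce, and grows with \<open>t\<close> on \<open>t z\<close>.
\<close>

lemma ball_image_disjoint_translate:
  assumes z: "z \<notin> h" "z = r *\<^sub>R heis_center"
  obtains t :: real where "\<And>x. coset x \<in> ball_image k \<Longrightarrow> coset (x + t *\<^sub>R z) \<notin> ball_image k"
proof -
  obtain y w where y: "y \<in> span h" "\<And>u. u \<in> span h \<Longrightarrow> orthogonal w u" "z = y + w"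
    by (rule orthogonal_subspace_decomp_exists [where S = h and x = z]) (rule that)
  have w_h: "w \<bullet> u = 0" if "u \<in> h" for u
    using y(2) [of u] that span_base by (auto simp: orthogonal_def)
  have "y \<in> h" using y(1) subspace_h span_eq_iff by blast
  then have "w \<noteq> 0" "w \<bullet> z = w \<bullet> w"
    using z(1) y(3) w_h by (auto simp: inner_add_right)
  then have wz: "w \<bullet> z > 0" by simp
  obtain K where K: "\<And>u v :: (real, 'n) heis. norm (heis_bracket u v) \<le> norm u * norm v * K" "K > 0"
    using bounded_bilinear.pos_bounded [OF bounded_bilinear_heis_bracket(1)] by blast
  \<comment> \<open>R bounds the functional on the elements v - v' - [v', v] / 2 that arise when two points v, v'
      of the ball lie in cosets that differ by a central translation.\<close>
  define R where "R = norm w * (2 * real k + real k * real k * K)"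
  have "R \<ge> 0" using K(2) by (simp add: R_def)
  define t where "t = (R + 1) / (w \<bullet> z)"
  show thesis
  proof
    fix x assume "coset x \<in> ball_image k"
    then obtain v where v: "norm v < k" "coset x = coset v" by (auto simp: ball_image_def)
    show "coset (x + t *\<^sub>R z) \<notin> ball_image k"
    proof
      assume "coset (x + t *\<^sub>R z) \<in> ball_image k"
      then obtain v' where v': "norm v' < k" "coset (x + t *\<^sub>R z) = coset v'" by (auto simp: ball_image_def)
      have "coset (x + t *\<^sub>R z) = coset (v + t *\<^sub>R z)"
        using central_flow_coset [of "t * r" x] central_flow_coset [of "t * r" v] v(2) z(2) by simp
      then have "coset v' = coset (v + t *\<^sub>R z)" using v' by simp
      then have *: "v + t *\<^sub>R z - v' - (1/2) *\<^sub>R heis_bracket v' v \<in> h"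
        by (simp add: coset_eq_iff z(2) heis_bracket_bilinear heis_bracket_scaleR scalar_mult_eq_scaleR)
      let ?e = "v - v' - (1/2) *\<^sub>R heis_bracket v' v"
      have "?e + t *\<^sub>R z \<in> h" using * by (simp add: algebra_simps)
      then have "w \<bullet> ?e + t * (w \<bullet> z) = 0" using w_h [of "?e + t *\<^sub>R z"] by (simp only: inner_add_right inner_scaleR_right)
      then have "R + 1 \<le> \<bar>w \<bullet> ?e\<bar>" using wz by (simp add: t_def)
      also have "\<dots> \<le> norm w * norm ?e" by (rule Cauchy_Schwarz_ineq2)
      also have "\<dots> \<le> R"
      proof -
        have "norm (heis_bracket v' v) \<le> real k * real k * K"
          using K(1) [of v' v] v(1) v'(1) K(2)
          by (meson less_imp_le mult_mono mult_right_mono norm_ge_zero of_nat_0_le_iff order_trans)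
        moreover have "norm ?e \<le> norm (v - v') + norm (heis_bracket v' v) / 2"
          using norm_triangle_ineq4 [of "v - v'" "(1/2) *\<^sub>R heis_bracket v' v"] by simp
        ultimately have "norm ?e \<le> 2 * real k + real k * real k * K"
          using v(1) v'(1) norm_triangle_ineq4 [of v v'] norm_ge_zero [of "heis_bracket v' v"] by linarith
        then show ?thesis unfolding R_def by (intro mult_left_mono) auto
      qed
      finally show False by simp
    qed
  qed
qed

text \<open>
  The two right translations are applied in either order to the indicator of the image of a ball. The
  results differ by a central translation, which is made so large, by scaling \<open>b\<close>, that their
  supports are disjoint.
\<close>

theorem not_multiplicity_free:
  assumes a: "centralizes_h a" and b: "centralizes_h b" and ab: "heis_bracket a b \<notin> h"
  shows "\<not> multiplicity_free G \<mu> (quasi_regular G)"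
proof
  assume mf: "multiplicity_free G \<mu> (quasi_regular G)"
  have "\<exists>k. emeasure \<mu> (ball_image k) \<noteq> 0"
  proof (rule ccontr)
    assume "\<nexists>k. emeasure \<mu> (ball_image k) \<noteq> 0"
    then have "ball_image k \<in> null_sets \<mu>" for k
      using openin_ball_image openin_sets by (auto simp: null_sets_def)
    then have "(\<Union>k. ball_image k) \<in> null_sets \<mu>" by (rule null_sets_UN)
    then show False
      using invariant by (simp add: range_ball_image null_sets_def invariant_measure_def)
  qed
  then obtain k where k: "emeasure \<mu> (ball_image k) \<noteq> 0" by blast
  have B: "ball_image k \<in> sets \<mu>" using openin_ball_image openin_sets by blast
  obtain r where "heis_bracket a b = r *\<^sub>R heis_center"
    using heis_bracket_central [of a b] by (auto simp: scalar_mult_eq_scaleR)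
  with ball_image_disjoint_translate [OF ab] obtain t where
    t: "\<And>x. coset x \<in> ball_image k \<Longrightarrow> coset (x + t *\<^sub>R heis_bracket a b) \<notin> ball_image k" by blast
  \<comment> \<open>The sign makes x b' a equal to x a b' translated by t [a, b].\<close>
  define b' where "b' = (- t) *\<^sub>R b"
  have b': "centralizes_h b'"
    using b by (simp add: centralizes_h_def b'_def heis_bracket_bilinear heis_bracket_scaleR)
  let ?ra = "right_translate a" and ?rb = "right_translate b'"
  define f :: "(real, 'n) heis set \<Rightarrow> complex" where "f = indicator (ball_image k)"
  have "(\<lambda>C. (cmod (f C))\<^sup>2) = indicator (ball_image k)" by (auto simp: f_def indicator_def)
  then have f: "f \<in> L2_functions \<mu>"
    using B emeasure_ball_image_finite [of k] by (simp add: L2_functions_def f_def)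
  define V where "V = ?ra -` (?rb -` ball_image k \<inter> space \<mu>) \<inter> space \<mu>"
  have rb_B: "?rb -` ball_image k \<inter> space \<mu> \<in> sets \<mu>"
    by (rule measurable_sets [OF measurable_right_translate [OF b'] B])
  then have V: "V \<in> sets \<mu>"
    unfolding V_def by (rule measurable_sets [OF measurable_right_translate [OF a]])
  have "emeasure \<mu> V = emeasure \<mu> (ball_image k)"
    using emeasure_distr [OF measurable_right_translate [OF a] rb_B]
      emeasure_distr [OF measurable_right_translate [OF b'] B]
    by (simp add: V_def distr_right_translate a b')
  have "AE C in \<mu>. f (?rb (?ra C)) = f (?ra (?rb C))"
    using mf intertwining_right_translate [OF a] intertwining_right_translate [OF b'] f
    unfolding multiplicity_free_def by blast
  then have "AE C in \<mu>. C \<notin> V"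
  proof (rule AE_mp, intro AE_I2 impI notI)
    fix C assume "C \<in> space \<mu>" and eq: "f (?rb (?ra C)) = f (?ra (?rb C))" and "C \<in> V"
    then obtain x where x: "C = coset x" by (auto simp: space_\<mu>)
    have "(x \<otimes>\<^bsub>G\<^esub> b') \<otimes>\<^bsub>G\<^esub> a = (x \<otimes>\<^bsub>G\<^esub> a) \<otimes>\<^bsub>G\<^esub> b' + t *\<^sub>R heis_bracket a b"
      by (simp add: mult_heis_group heis_bracket_bilinear b'_def heis_bracket_scaleR
          heis_bracket_skew [of b a] scalar_mult_eq_scaleR algebra_simps)
        (simp add: vec_eq_iff algebra_simps)
    then show False
      using eq t [of "(x \<otimes>\<^bsub>G\<^esub> a) \<otimes>\<^bsub>G\<^esub> b'"] \<open>C \<in> V\<close>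
      by (auto simp: x V_def f_def right_translate_coset a b')
  qed
  then have "V \<in> null_sets \<mu>" using AE_iff_null_sets [OF V] by simp
  then show False using \<open>emeasure \<mu> V = _\<close> k by (simp add: null_sets_def)
qed

end

section \<open>Dual bases and the coadjoint action\<close>

lemma dual_vector_apply:
  fixes B :: "('v::euclidean_space) set"
  assumes B: "independent B" "span B = UNIV" and b: "b' \<in> B"
  shows "blinfun_apply (dual_vector B b) b' = (if b' = b then 1 else 0)"
proof -
  obtain g :: "'v \<Rightarrow> real" where g: "linear g" "\<forall>x\<in>B. g x = (if x = b then 1 else 0)"
    using linear_independent_extend [OF B(1), of "\<lambda>x. if x = b then 1 else 0"] by (elim exE conjE)
  then have g_apply: "blinfun_apply (Blinfun g) = g"
    by (simp add: bounded_linear_Blinfun_apply linear_conv_bounded_linear)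
  have "\<exists>!\<xi> :: 'v \<Rightarrow>\<^sub>L real. \<forall>b'\<in>B. blinfun_apply \<xi> b' = (if b' = b then 1 else 0)"
  proof (rule ex1I)
    show "\<forall>b'\<in>B. blinfun_apply (Blinfun g) b' = (if b' = b then 1 else 0)"
      using g g_apply by simp
    fix \<xi> :: "'v \<Rightarrow>\<^sub>L real" assume \<xi>: "\<forall>b'\<in>B. blinfun_apply \<xi> b' = (if b' = b then 1 else 0)"
    show "\<xi> = Blinfun g"
    proof (rule blinfun_eqI)
      fix x
      have "blinfun_apply \<xi> x = g x"
        by (rule linear_eq_on [OF bounded_linear.linear [OF blinfun.bounded_linear_right] g(1), of x B])
          (use B(2) \<xi> g in auto)
      then show "blinfun_apply \<xi> x = blinfun_apply (Blinfun g) x" by (simp add: g_apply)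
    qed
  qed
  from theI' [OF this] show ?thesis using b unfolding dual_vector_def by blast
qed

lemma inj_on_dual_vector:
  fixes B :: "('v::euclidean_space) set"
  assumes B: "independent B" "span B = UNIV"
  shows "inj_on (dual_vector B) B"
proof (rule inj_onI)
  fix b c assume "b \<in> B" "c \<in> B" "dual_vector B b = dual_vector B c"
  then show "b = c"
    using dual_vector_apply [OF B \<open>b \<in> B\<close>, of b] dual_vector_apply [OF B \<open>b \<in> B\<close>, of c]
    by (simp split: if_splits)
qed

lemma independent_dual_vectors:
  fixes B :: "('v::euclidean_space) set"
  assumes B: "independent B" "span B = UNIV" and S: "S \<subseteq> B"
  shows "independent (dual_vector B ` S)"
proof (rule independent_if_scalars_zero)
  have fin: "finite S" by (rule finite_subset [OF S finiteI_independent [OF B(1)]])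
  then show "finite (dual_vector B ` S)" by simp
  fix f x assume sum: "(\<Sum>x\<in>dual_vector B ` S. f x *\<^sub>R x) = 0" and "x \<in> dual_vector B ` S"
  then obtain b where b: "b \<in> S" "x = dual_vector B b" by blast
  have "inj_on (dual_vector B) S" by (rule inj_on_subset [OF inj_on_dual_vector [OF B] S])
  then have "(\<Sum>c\<in>S. f (dual_vector B c) *\<^sub>R dual_vector B c) = 0"
    using sum by (simp add: sum.reindex)
  then have "0 = blinfun_apply (\<Sum>c\<in>S. f (dual_vector B c) *\<^sub>R dual_vector B c) b"
    by simp
  also have "\<dots> = (\<Sum>c\<in>S. f (dual_vector B c) * (if b = c then 1 else 0))"
    using S b(1) dual_vector_apply [OF B, of b]
    by (auto simp: blinfun.sum_left blinfun.scaleR_left intro!: sum.cong)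
  also have "\<dots> = f x" using fin b by (simp add: if_distrib cong: if_cong)
  finally show "f x = 0" by simp
qed

lemma heis_Ad_eq: "heis_Ad g w = w + heis_bracket g w"
proof -
  have "inv_into UNIV heis_exp y = y" for y :: "(real, 'n::finite) heis"
    using inv_into_f_f [of heis_exp UNIV y] by (simp add: heis_exp_def inj_def)
  then have "heis_Ad g w = g \<otimes>\<^bsub>heis_group\<^esub> w \<otimes>\<^bsub>heis_group\<^esub> - g"
    by (simp add: heis_Ad_def heis_exp_def)
  also have "\<dots> = w + heis_bracket g w"
    by (simp add: mult_heis_group heis_bracket_bilinear heis_bracket_skew [of w g] vec_eq_iff)
  finally show ?thesis .
qed

lemma coadjoint_apply:
  "blinfun_apply (coadjoint g \<xi>) w = blinfun_apply \<xi> w - blinfun_apply \<xi> (heis_bracket g w)"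
proof -
  have "bounded_linear (\<lambda>w. w - heis_bracket g w)"
    by (rule bounded_linear_sub [OF bounded_linear_ident
        bounded_bilinear.bounded_linear_right [OF bounded_bilinear_heis_bracket(1)]])
  from bounded_linear_compose [OF blinfun.bounded_linear_right this]
  have "bounded_linear (\<lambda>w. blinfun_apply \<xi> (w - heis_bracket g w))" .
  then show ?thesis
    by (simp add: coadjoint_def heis_Ad_eq heis_bracket_minus_left bounded_linear_Blinfun_apply
        flip: blinfun.diff_right)
qed

section \<open>Heisenberg bases and the rank of the support\<close>

text \<open>
  Every adapted basis yields such a situation, with \<open>A\<close> the part of the basis that spans \<open>h\<close>.
\<close>

locale heisenberg_splitting =
  fixes X Y :: "nat \<Rightarrow> (real, 'n::finite) heis" and Z :: "(real, 'n) heis"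
    and A :: "(real, 'n) heis set"
  assumes basis: "heisenberg_basis X Y Z" and A_subset: "A \<subseteq> basis_set X Y Z"
begin

abbreviation "B \<equiv> basis_set X Y Z"
abbreviation "h \<equiv> span A"
abbreviation "q \<equiv> span (B - A)"

lemma indep_B: "independent B" and span_B: "span B = UNIV"
  using basis by (auto simp: heisenberg_basis_def)

lemma finite_B: "finite B" by (simp add: basis_set_def)

lemma bracket_XY: "i \<in> {1..CARD('n)} \<Longrightarrow> j \<in> {1..CARD('n)} \<Longrightarrow> heis_bracket (X i) (Y j) = (if i = j then Z else 0)"
  and bracket_XX: "i \<in> {1..CARD('n)} \<Longrightarrow> j \<in> {1..CARD('n)} \<Longrightarrow> heis_bracket (X i) (X j) = 0"
  and bracket_YY: "i \<in> {1..CARD('n)} \<Longrightarrow> j \<in> {1..CARD('n)} \<Longrightarrow> heis_bracket (Y i) (Y j) = 0"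
  using basis by (auto simp: heisenberg_basis_def)

lemma Z_in_B: "Z \<in> B" and Z_nonzero: "Z \<noteq> 0"
  using dependent_zero [of B] indep_B by (auto simp: basis_set_def)

lemma Z_central: obtains c where "c \<noteq> 0" "Z = c *\<^sub>R heis_center"
proof -
  have "Z = heis_bracket (X 1) (Y 1)" using bracket_XY [of 1 1] by (simp add: Suc_le_eq)
  then obtain c where "Z = c *\<^sub>R heis_center"
    using heis_bracket_central [of "X 1" "Y 1"] by (auto simp: scalar_mult_eq_scaleR)
  then show thesis using that Z_nonzero by auto
qed

lemma bracket_Z [simp]: "heis_bracket Z v = 0" "heis_bracket v Z = 0"
  using Z_central by (metis heis_bracket_center heis_bracket_scaleR scaleR_zero_right)+

lemma bracket_in_span_Z: "\<exists>r. heis_bracket u v = r *\<^sub>R Z"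
proof -
  obtain c where c: "c \<noteq> 0" "Z = c *\<^sub>R heis_center" by (rule Z_central)
  obtain d where "heis_bracket u v = d *\<^sub>R heis_center"
    using heis_bracket_central [of u v] by (auto simp: scalar_mult_eq_scaleR)
  then have "heis_bracket u v = (d / c) *\<^sub>R Z" using c by simp
  then show ?thesis by blast
qed

lemma X_neq_Z: "i \<in> {1..CARD('n)} \<Longrightarrow> X i \<noteq> Z"
  and Y_neq_Z: "i \<in> {1..CARD('n)} \<Longrightarrow> Y i \<noteq> Z"
  using bracket_XY [of i i] Z_nonzero bracket_Z by metis+

lemma B_minus_h: "B - h = B - A" and B_int_q: "B \<inter> q = B - A"
proof -
  have not_in: "b \<notin> span (B - {b})" if "b \<in> B" for b
    using indep_B that by (auto simp: dependent_def)
  have "b \<notin> h" if "b \<in> B - A" for b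
    using not_in [of b] that span_mono [of A "B - {b}"] A_subset by auto
  then show "B - h = B - A" using span_superset [of A] by auto
  have "b \<notin> q" if "b \<in> A" for b
    using not_in [of b] that span_mono [of "B - A" "B - {b}"] A_subset by auto
  then show "B \<inter> q = B - A" using span_superset [of "B - A"] by auto
qed

lemma dim_q: "dim q = card (B - A)"
  and dim_diff: "DIM((real, 'n) heis) - dim h = dim q"
proof -
  have "dim (span C) = card C" if "C \<subseteq> B" for C
    using independent_mono [OF indep_B that] by (simp add: dim_eq_card_independent dim_span)
  from this [OF A_subset] this [of "B - A"] this [of B]
  show "dim q = card (B - A)" "DIM((real, 'n) heis) - dim h = dim q"
    using card_Diff_subset [OF finite_subset [OF A_subset finite_B] A_subset]
    by (simp_all add: span_B dim_UNIV)
qed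

abbreviation "dual \<equiv> dual_vector B"

lemmas dual_apply = dual_vector_apply [OF indep_B span_B]

lemma dual_of_q: "dual_of X Y Z q = span (dual ` (B - A))"
  by (simp add: dual_of_def B_int_q)

lemma xi_in_cross_section: "xi X Y Z \<alpha> \<beta> 0 \<in> cross_section X Y Z"
  by (auto simp: cross_section_def)

lemma dual_in_cross_section:
  assumes "b \<in> B"
  shows "dual b \<in> cross_section X Y Z"
proof -
  consider i where "i \<in> {1..CARD('n)}" "b = X i" | i where "i \<in> {1..CARD('n)}" "b = Y i" | "b = Z"
    using assms by (auto simp: basis_set_def)
  then show ?thesis
  proof cases
    case 1
    then have "xi X Y Z (\<lambda>j. if j = i then 1 else 0) (\<lambda>_. 0) 0 = dual b"
      by (simp add: xi_def if_distrib [of "\<lambda>c. c *\<^sub>R _"] cong: if_cong)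
    then show ?thesis using xi_in_cross_section by metis
  next
    case 2
    then have "xi X Y Z (\<lambda>_. 0) (\<lambda>j. if j = i then 1 else 0) 0 = dual b"
      by (simp add: xi_def if_distrib [of "\<lambda>c. c *\<^sub>R _"] cong: if_cong)
    then show ?thesis using xi_in_cross_section by metis
  next
    case 3
    then have "xi X Y Z (\<lambda>_. 0) (\<lambda>_. 0) 1 = dual b" by (simp add: xi_def)
    moreover have "xi X Y Z (\<lambda>_. 0) (\<lambda>_. 0) 1 \<in> cross_section X Y Z"
      unfolding cross_section_def by (intro UnI1 CollectI exI [of _ 1]) simp
    ultimately show ?thesis by simp
  qed
qed

lemma xi_Z: "blinfun_apply (xi X Y Z \<alpha> \<beta> 0) Z = 0"
proof -
  have "blinfun_apply (dual (X i)) Z = 0" "blinfun_apply (dual (Y i)) Z = 0" if "i \<in> {1..CARD('n)}" for i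
    using X_neq_Z [OF that] Y_neq_Z [OF that] dual_apply [OF Z_in_B] by auto
  then show ?thesis
    by (simp add: xi_def blinfun.add_left blinfun.sum_left blinfun.scaleR_left)
qed

lemma coadjoint_trivial:
  assumes "blinfun_apply \<xi> Z = 0"
  shows "coadjoint g \<xi> = \<xi>"
proof (rule blinfun_eqI)
  fix w
  obtain r where "heis_bracket g w = r *\<^sub>R Z" using bracket_in_span_Z by blast
  then show "blinfun_apply (coadjoint g \<xi>) w = blinfun_apply \<xi> w"
    using assms by (simp add: coadjoint_apply blinfun.scaleR_right)
qed

text \<open>
  The value at \<open>Z\<close> is constant on coadjoint orbits. If it is zero, the orbit is a point. If not, the
  orbit meets the cross-section in a multiple of \<open>Z\<^sup>*\<close>, and \<open>Z\<close> is one of the basis vectors in \<open>q\<close>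
  because \<open>\<xi> \<in> q\<^sup>*\<close> does not vanish there.
\<close>

lemma orbit_parameters_subset: "orbit_parameters X Y Z q \<subseteq> dual_of X Y Z q"
proof
  fix \<eta> assume "\<eta> \<in> orbit_parameters X Y Z q"
  then obtain g \<xi> where \<eta>: "\<eta> \<in> cross_section X Y Z" "\<eta> = coadjoint g \<xi>" and \<xi>: "\<xi> \<in> span (dual ` (B - A))"
    by (auto simp: orbit_parameters_def dual_of_q)
  have same_Z: "blinfun_apply \<eta> Z = blinfun_apply \<xi> Z" by (simp add: \<eta>(2) coadjoint_apply)
  show "\<eta> \<in> dual_of X Y Z q"
  proof (cases "blinfun_apply \<xi> Z = 0")
    case True
    then show ?thesis using coadjoint_trivial \<eta> \<xi> by (simp add: dual_of_q)
  next
    case False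
    have "Z \<notin> A"
    proof
      assume "Z \<in> A"
      have "linear (\<lambda>\<zeta>. blinfun_apply \<zeta> Z)"
        by (rule linearI) (simp_all add: blinfun.add_left blinfun.scaleR_left)
      moreover have "blinfun_apply \<zeta> Z = 0" if "\<zeta> \<in> dual ` (B - A)" for \<zeta>
        using that \<open>Z \<in> A\<close> dual_apply [OF Z_in_B] by auto
      ultimately show False using \<xi> False linear_eq_0_on_span by blast
    qed
    moreover obtain \<gamma> where "\<eta> = xi X Y Z (\<lambda>_. 0) (\<lambda>_. 0) \<gamma>"
      using \<eta>(1) False same_Z xi_Z by (auto simp: cross_section_def)
    ultimately show ?thesis
      using Z_in_B span_scale [OF span_base [of "dual Z" "dual ` (B - A)"], of \<gamma>]
      by (simp add: xi_def dual_of_q)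
  qed
qed

text \<open>
  The dual basis vectors of \<open>q\<^sup>*\<close> lie in the cross-section, so they are orbit parameters, and all
  the others are linear combinations of them.
\<close>

theorem rank_Supp_eq: "rank_Supp X Y Z q = dim q"
  unfolding rank_Supp_def
proof (rule Least_equality)
  have S: "B - A \<subseteq> B" by simp
  have card: "card (dual ` (B - A)) = dim q"
    using card_image [OF inj_on_subset [OF inj_on_dual_vector [OF indep_B span_B] S]] by (simp only: dim_q)
  have indep: "independent (dual ` (B - A))"
    by (rule independent_dual_vectors [OF indep_B span_B S])
  show "\<exists>D\<subseteq>dual_of X Y Z q. finite D \<and> independent D \<and> card D = dim q \<and> orbit_parameters X Y Z q \<subseteq> span D"
    using indep card orbit_parameters_subset finite_B
    by (intro exI [of _ "dual ` (B - A)"]) (auto simp: dual_of_q intro: span_base)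
  fix k
  assume "\<exists>D\<subseteq>dual_of X Y Z q. finite D \<and> independent D \<and> card D = k \<and> orbit_parameters X Y Z q \<subseteq> span D"
  then obtain D where D: "finite D" "card D = k" "orbit_parameters X Y Z q \<subseteq> span D" by blast
  have "dual ` (B - A) \<subseteq> orbit_parameters X Y Z q"
  proof
    fix \<eta> assume "\<eta> \<in> dual ` (B - A)"
    then have "\<eta> \<in> cross_section X Y Z" "\<eta> \<in> dual_of X Y Z q"
      using dual_in_cross_section by (auto simp: dual_of_q span_base)
    moreover have "coadjoint 0 \<eta> = \<eta>" by (rule blinfun_eqI) (simp add: coadjoint_apply)
    ultimately show "\<eta> \<in> orbit_parameters X Y Z q"
      unfolding orbit_parameters_def by (intro IntI CollectI exI [of _ 0] exI [of _ \<eta>]) simp_all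
  qed
  then have "card (dual ` (B - A)) \<le> card D"
    using independent_span_bound [OF D(1) indep] D(3) by blast
  then show "dim q \<le> k" by (simp add: card D(2))
qed

definition proj :: "(real, 'n) heis \<Rightarrow> (real, 'n) heis" where
  "proj = (SOME p. linear p \<and> (\<forall>b\<in>B. p b = (if b \<in> A then 0 else b)))"

lemma linear_proj: "linear proj" and proj_basis: "b \<in> B \<Longrightarrow> proj b = (if b \<in> A then 0 else b)"
proof -
  have "\<exists>p :: (real, 'n) heis \<Rightarrow> (real, 'n) heis. linear p \<and> (\<forall>b\<in>B. p b = (if b \<in> A then 0 else b))"
    by (rule linear_independent_extend [OF indep_B])
  from someI_ex [OF this] show "linear proj" "b \<in> B \<Longrightarrow> proj b = (if b \<in> A then 0 else b)"
    by (auto simp: proj_def)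
qed

lemma proj_h: "u \<in> h \<Longrightarrow> proj u = 0"
  by (rule linear_eq_0_on_span [OF linear_proj, of A]) (use proj_basis A_subset in auto)

lemma proj_q: "v \<in> q \<Longrightarrow> proj v = v"
  by (rule linear_eq_on [OF linear_proj linear_ident, of v "B - A"]) (use proj_basis in auto)

lemma proj_in_q: "proj x \<in> q"
proof -
  have "proj x \<in> span (proj ` B)"
    using linear_span_image [OF linear_proj, of B] span_B by auto
  moreover have "proj ` B \<subseteq> q" using proj_basis by (auto simp: span_base span_zero)
  ultimately show ?thesis using span_minimal [OF _ subspace_span] by blast
qed

lemma minus_proj_in_h: "x - proj x \<in> h"
proof -
  have lin: "linear (\<lambda>x. x - proj x)"
    by (intro linear_compose_sub linear_ident linear_proj)
  have "x - proj x \<in> span ((\<lambda>x. x - proj x) ` B)"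
    using linear_span_image [OF lin, of B] span_B by auto
  moreover have "(\<lambda>x. x - proj x) ` B \<subseteq> h" using proj_basis by (auto simp: span_base span_zero)
  ultimately show ?thesis using span_minimal [OF _ subspace_span] by blast
qed

end

section \<open>A global coordinate on the complex homogeneous space\<close>

definition complex_extension :: "(real ^ 'm \<Rightarrow> real ^ 'm) \<Rightarrow> complex ^ 'm \<Rightarrow> complex ^ 'm" where
  "complex_extension p x = complexify (p (\<chi> i. Re (x $ i))) + \<i> *s complexify (p (\<chi> i. Im (x $ i)))"

lemma complex_extension_apply [simp]:
  "complex_extension p (complexify u + \<i> *s complexify v) = complexify (p u) + \<i> *s complexify (p v)"
proof -
  have "(\<chi> i. Re ((complexify u + \<i> *s complexify v) $ i)) = u"
    "(\<chi> i. Im ((complexify u + \<i> *s complexify v) $ i)) = v"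
    by (simp_all add: complexify_def vec_eq_iff)
  then show ?thesis by (simp add: complex_extension_def)
qed

lemma complexify_add: "complexify (u + v) = complexify u + complexify v"
  and complexify_diff: "complexify (u - v) = complexify u - complexify v"
  by (simp_all add: complexify_def vec_eq_iff)

lemma complex_scale:
  "c *s (complexify u + \<i> *s complexify v) =
    complexify (Re c *\<^sub>R u - Im c *\<^sub>R v) + \<i> *s complexify (Im c *\<^sub>R u + Re c *\<^sub>R v)"
  by (simp add: complexify_def vec_eq_iff complex_eq_iff)

lemma complex_sum:
  "(complexify u + \<i> *s complexify v) + (complexify u' + \<i> *s complexify v') =
    complexify (u + u') + \<i> *s complexify (v + v')"
  by (simp add: complexify_def vec_eq_iff complex_eq_iff)

lemma complex_extension_linear:
  assumes "linear p"
  shows "complex_extension p (x + y) = complex_extension p x + complex_extension p y"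
    "complex_extension p (c *s x) = c *s complex_extension p x"
proof -
  obtain u v where x: "x = complexify u + \<i> *s complexify v" by (rule complex_vec_cases)
  obtain u' v' where y: "y = complexify u' + \<i> *s complexify v'" by (rule complex_vec_cases)
  show "complex_extension p (x + y) = complex_extension p x + complex_extension p y"
    unfolding x y complex_sum complex_extension_apply
    by (simp add: linear_add [OF assms] complex_sum)
  show "complex_extension p (c *s x) = c *s complex_extension p x"
    unfolding x complex_scale complex_extension_apply
    by (simp add: linear_add [OF assms] linear_diff [OF assms] linear_scale [OF assms])
qed

lemma heis_bracket_complexify: "heis_bracket (complexify u) (complexify v) = complexify (heis_bracket u v)"
  by (auto simp: heis_bracket_def complexify_def vec_eq_iff split: sum.split)

lemma heis_bracket_complex:
  "heis_bracket (complexify u + \<i> *s complexify v) (complexify u' + \<i> *s complexify v') =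
    complexify (heis_bracket u u' - heis_bracket v v') + \<i> *s complexify (heis_bracket u v' + heis_bracket v u')"
  by (simp add: heis_bracket_bilinear heis_bracket_complexify complexify_add complexify_diff
      vec_eq_iff algebra_simps)

text \<open>
  The first alternative holds when \<open>h\<close> contains the centre, the second for \<open>h\<close> spanned by
  \<open>X\<^sub>1, \<dots>, X\<^sub>n\<close> with \<open>q\<close> spanned by the \<open>Y\<^sub>j\<close> and \<open>Z\<close>. \<open>p\<close> is the projection to \<open>q\<close> along \<open>h\<close>.
\<close>

locale heisenberg_polarization =
  fixes h q :: "(real, 'n::finite) heis set" and p :: "(real, 'n) heis \<Rightarrow> (real, 'n) heis"
  assumes subspace_h: "subspace h" and subspace_q: "subspace q" and linear_p: "linear p"
    and p_h: "u \<in> h \<Longrightarrow> p u = 0" and p_q: "v \<in> q \<Longrightarrow> p v = v"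
    and p_in_q: "p x \<in> q" and minus_p_in_h: "x - p x \<in> h"
    and brackets: "(\<forall>u v. heis_bracket u v \<in> h) \<or>
      (\<forall>u v. heis_bracket u v \<in> q) \<and> (\<forall>u\<in>h. \<forall>v\<in>h. heis_bracket u v = 0) \<and>
      (\<forall>u\<in>q. \<forall>v\<in>q. heis_bracket u v = 0)"
begin

abbreviation "hC \<equiv> complexification h"
abbreviation "qC \<equiv> complexification q"
abbreviation "pC \<equiv> complex_extension p"

lemmas pC_add = complex_extension_linear(1) [OF linear_p]
lemmas pC_scale = complex_extension_linear(2) [OF linear_p]

lemma pC_diff: "pC (x - y) = pC x - pC y"
  using pC_add [of "x - y" y] by simp

lemma pC_0 [simp]: "pC 0 = 0"
  using pC_scale [of 0 0] by simp

lemma complex_in_iff [simp]: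
  "complexify u + \<i> *s complexify v \<in> complexification k \<longleftrightarrow> u \<in> k \<and> v \<in> k"
  by (auto simp: complexification_def)

lemma pC_in_qC: "pC x \<in> qC"
  by (rule complex_vec_cases [of x]) (simp add: p_in_q)

lemma pC_qC: "x \<in> qC \<Longrightarrow> pC x = x"
  by (auto simp: complexification_def p_q)

lemma p_eq_0_iff: "p u = 0 \<longleftrightarrow> u \<in> h"
  using p_h minus_p_in_h [of u] by auto

lemma pC_eq_0_iff: "pC x = 0 \<longleftrightarrow> x \<in> hC"
proof -
  obtain u v where x: "x = complexify u + \<i> *s complexify v" by (rule complex_vec_cases)
  have "pC x = 0 \<longleftrightarrow> p u = 0 \<and> p v = 0"
    using complexify_imaginary_eq [of "p u" "p v" 0 0] by (simp add: x)
  then show ?thesis by (simp add: x p_eq_0_iff)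
qed

lemma minus_pC_in_hC: "x - pC x \<in> hC"
  using pC_qC [OF pC_in_qC, of x] by (simp flip: pC_eq_0_iff add: pC_diff)

lemma complex_brackets:
  obtains "\<And>x y. heis_bracket x y \<in> hC"
  | "\<And>x y. heis_bracket x y \<in> qC" "\<And>x y. x \<in> hC \<Longrightarrow> y \<in> hC \<Longrightarrow> heis_bracket x y = 0"
    "\<And>x y. x \<in> qC \<Longrightarrow> y \<in> qC \<Longrightarrow> heis_bracket x y = 0"
proof -
  have in_k: "heis_bracket x y \<in> complexification k"
    if "subspace k" "\<forall>u v. heis_bracket u v \<in> k" for x y and k :: "(real, 'n) heis set"
    by (rule complex_vec_cases [of x], rule complex_vec_cases [of y])
      (simp add: heis_bracket_complex that subspace_add subspace_diff)
  have zero: "heis_bracket x y = 0"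
    if "x \<in> complexification k" "y \<in> complexification k" "\<forall>u\<in>k. \<forall>v\<in>k. heis_bracket u v = 0"
    for x y and k :: "(real, 'n) heis set"
    using that by (auto simp: complexification_def heis_bracket_complex)
  show thesis
    using brackets
  proof
    assume "\<forall>u v. heis_bracket u v \<in> h"
    then show thesis using that(1) in_k [OF subspace_h] by blast
  next
    assume "(\<forall>u v. heis_bracket u v \<in> q) \<and> (\<forall>u\<in>h. \<forall>v\<in>h. heis_bracket u v = 0) \<and>
      (\<forall>u\<in>q. \<forall>v\<in>q. heis_bracket u v = 0)"
    then show thesis using that(2) in_k [OF subspace_q] zero [of _ h] zero [of _ q] by blast
  qed
qed

text \<open>
  The point of the complexified \<open>q\<close> in the coset of \<open>x\<close>. If brackets lie in \<open>q\<close>, solving \<open>x = w \<otimes> u\<close>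
  with \<open>w\<close> in the complexified \<open>q\<close> and \<open>u\<close> in the complexified \<open>h\<close> gives \<open>u = x - pC x\<close> and
  \<open>w = pC x - [pC x, x] / 2\<close>. If brackets lie in \<open>h\<close>, the outer \<open>pC\<close> removes the second term,
  and what remains is the projection modulo a normal subgroup.
\<close>

definition coord :: "(complex, 'n) heis \<Rightarrow> (complex, 'n) heis" where
  "coord x = pC (x - (1/2) *s heis_bracket (pC x) x)"

abbreviation "G \<equiv> heis_group :: (complex, 'n) heis monoid"

lemma subspace_hC: "vec.subspace hC" by (rule subspace_complexification [OF subspace_h])

lemma bracket_hC:
  assumes "x \<in> hC" "y \<in> hC"
  shows "heis_bracket x y \<in> hC"
  by (rule complex_brackets) (use assms vec.subspace_0 [OF subspace_hC] in auto)

lemma subgroup_hC: "subgroup hC G"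
proof (rule subgroup.intro)
  show "x \<otimes>\<^bsub>G\<^esub> y \<in> hC" if "x \<in> hC" "y \<in> hC" for x y
    using that by (auto simp: mult_heis_group
        intro!: vec.subspace_add vec.subspace_scale subspace_hC bracket_hC)
qed (auto simp: vec.subspace_0 vec.subspace_neg subspace_hC)

text \<open>
  When brackets lie in \<open>q\<close>, each side forces \<open>pC y - pC x\<close> to be central, and under this condition the
  quadratic terms of the two sides agree, because brackets vanish within \<open>h\<close> and within \<open>q\<close>.
\<close>

lemma coord_eq_iff: "coord y = coord x \<longleftrightarrow> - x \<otimes>\<^bsub>G\<^esub> y \<in> hC"
proof -
  have rhs: "- x \<otimes>\<^bsub>G\<^esub> y \<in> hC \<longleftrightarrow> pC y - pC x - (1/2) *s pC (heis_bracket x y) = 0"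
    by (simp add: mult_heis_group heis_bracket_minus_left vec.scale_minus_right pC_diff pC_scale
        flip: pC_eq_0_iff)
  show ?thesis
  proof (rule complex_brackets)
    assume "\<And>x y. heis_bracket x y \<in> hC"
    then have "pC (heis_bracket x y) = 0" for x y using pC_eq_0_iff by blast
    then show ?thesis by (simp add: rhs coord_def pC_diff pC_scale)
  next
    assume central: "\<And>x y. heis_bracket x y \<in> qC" and h0: "\<And>x y. x \<in> hC \<Longrightarrow> y \<in> hC \<Longrightarrow> heis_bracket x y = 0"
      and q0: "\<And>x y. x \<in> qC \<Longrightarrow> y \<in> qC \<Longrightarrow> heis_bracket x y = 0"
    have coord: "coord z = pC z - (1/2) *s heis_bracket (pC z) z" for z
      using pC_qC [OF central] by (simp add: coord_def pC_diff pC_scale)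
    have rhs': "- x \<otimes>\<^bsub>G\<^esub> y \<in> hC \<longleftrightarrow> pC y - pC x = (1/2) *s heis_bracket x y"
      using pC_qC [OF central] by (simp add: rhs)
    have lhs': "coord y = coord x \<longleftrightarrow> pC y - pC x = (1/2) *s (heis_bracket (pC y) y - heis_bracket (pC x) x)"
      unfolding coord vec.scale_right_diff_distrib by (auto simp: algebra_simps)
    have key: "heis_bracket (pC y) y - heis_bracket (pC x) x = heis_bracket x y"
      if "\<And>w. heis_bracket (pC y - pC x) w = 0"
    proof -
      have same: "heis_bracket (pC y) w = heis_bracket (pC x) w" for w
        using that [of w] by (simp add: heis_bracket_diff_left)
      have "heis_bracket x y = heis_bracket (pC x + (x - pC x)) (pC y + (y - pC y))" by simp
      also have "\<dots> = heis_bracket (pC x) (y - pC y) + heis_bracket (x - pC x) (pC y)"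
        using h0 [OF minus_pC_in_hC [of x] minus_pC_in_hC [of y]] q0 [OF pC_in_qC [of x] pC_in_qC [of y]]
        by (simp only: heis_bracket_add_left heis_bracket_add_right) simp
      also have "\<dots> = heis_bracket (pC x) (y - pC y) - heis_bracket (pC y) (x - pC x)"
        by (simp add: heis_bracket_skew [of "x - pC x" "pC y"])
      also have "\<dots> = heis_bracket (pC y) y - heis_bracket (pC x) x"
        using same [of x] same [of y] same [of "pC x"] q0 [OF pC_in_qC [of x] pC_in_qC [of y]]
        by (simp add: heis_bracket_diff_right)
      finally show ?thesis by simp
    qed
    show ?thesis
    proof
      assume "coord y = coord x"
      then have eq: "pC y - pC x = (1/2) *s (heis_bracket (pC y) y - heis_bracket (pC x) x)" using lhs' by simp
      have "heis_bracket (pC y - pC x) w = 0" for w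
        unfolding eq by (simp add: heis_bracket_scale_left heis_bracket_diff_left)
      then show "- x \<otimes>\<^bsub>G\<^esub> y \<in> hC" using key eq rhs' by simp
    next
      assume "- x \<otimes>\<^bsub>G\<^esub> y \<in> hC"
      then have eq: "pC y - pC x = (1/2) *s heis_bracket x y" using rhs' by simp
      have "heis_bracket (pC y - pC x) w = 0" for w
        unfolding eq by (simp add: heis_bracket_scale_left)
      then show "coord y = coord x" using key eq lhs' by simp
    qed
  qed
qed

lemma fibre_coord: "x <#\<^bsub>G\<^esub> hC = coord -` {coord x}"
proof (rule Set.set_eqI)
  fix y
  have "y \<in> x <#\<^bsub>G\<^esub> hC \<longleftrightarrow> - x \<otimes>\<^bsub>G\<^esub> y \<in> hC"
    using subgroup.lcos_module_imp [OF subgroup_hC group_heis_group, of x y]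
      subgroup.lcos_module_rev [OF subgroup_hC group_heis_group, of x y] by auto
  then show "y \<in> x <#\<^bsub>G\<^esub> hC \<longleftrightarrow> y \<in> coord -` {coord x}" by (simp add: coord_eq_iff)
qed

lemma coord_qC:
  assumes "w \<in> qC"
  shows "coord w = w"
  using pC_qC [OF assms] by (simp add: coord_def)

lemma holomorphic_coord: "holomorphic_map_on coord UNIV"
  unfolding holomorphic_map_on_def
proof
  fix x
  have "linear pC"
    by (rule linearI) (simp_all add: pC_add pC_scale scaleR_complex_vec)
  then have bl: "bounded_linear pC" by (simp add: linear_conv_bounded_linear)
  have "linear (\<lambda>v :: (complex, 'n) heis. (1/2) *s v)"
    by (rule linearI) (simp_all add: vec.scale_right_distrib scaleR_complex_vec)
  then have bl2: "bounded_linear (\<lambda>v :: (complex, 'n) heis. (1/2) *s v)" by (simp add: linear_conv_bounded_linear)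
  have d: "(pC has_derivative pC) (at x)" by (rule bounded_linear_imp_has_derivative [OF bl])
  have "((\<lambda>x. heis_bracket (pC x) x) has_derivative (\<lambda>v. heis_bracket (pC x) v + heis_bracket (pC v) x)) (at x)"
    by (rule bounded_bilinear.FDERIV [OF bounded_bilinear_heis_bracket(2) d has_derivative_ident])
  from bounded_linear.has_derivative [OF bl has_derivative_diff [OF has_derivative_ident
        bounded_linear.has_derivative [OF bl2 this]]]
  have "(coord has_derivative
      (\<lambda>v. pC (v - (1/2) *s (heis_bracket (pC x) v + heis_bracket (pC v) x)))) (at x)"
    by (simp add: coord_def [abs_def])
  moreover have "pC (c *s v - (1/2) *s (heis_bracket (pC x) (c *s v) + heis_bracket (pC (c *s v)) x)) =
      c *s pC (v - (1/2) *s (heis_bracket (pC x) v + heis_bracket (pC v) x))" for c v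
    unfolding pC_scale [symmetric]
    by (rule arg_cong [where f = pC])
      (simp add: pC_scale heis_bracket_bilinear vec_eq_iff algebra_simps)
  ultimately show "\<exists>f'. (\<forall>c v. f' (c *s v) = c *s f' v) \<and> (coord has_derivative f') (at x within UNIV)"
    by (intro exI [of _ "\<lambda>v. pC (v - (1/2) *s (heis_bracket (pC x) v + heis_bracket (pC v) x))"]) simp
qed

lemma pC_complexify: "pC (complexify v) = complexify (p v)"
  using complex_extension_apply [of p v 0] linear_0 [OF linear_p] by simp

text \<open>
  If brackets lie in \<open>h\<close>, then \<open>coord\<close> is a homomorphism. Otherwise the group element must come from
  the abelian \<open>q\<close>, whose brackets with \<open>pC x\<close> vanish, and the brackets with \<open>x\<close> cancel.
\<close>

lemma coord_translate:
  assumes "(\<forall>u v. heis_bracket u v \<in> h) \<or> g \<in> q"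
  shows "coord (complexify g \<otimes>\<^bsub>G\<^esub> x) = complexify (p g) + coord x"
proof (cases "\<forall>u v. heis_bracket u v \<in> h")
  case True
  have "pC (heis_bracket x y) = 0" for x y
    unfolding pC_eq_0_iff
    by (rule complex_vec_cases [of x], rule complex_vec_cases [of y])
      (use True in \<open>simp add: heis_bracket_complex subspace_add subspace_diff subspace_h\<close>)
  then show ?thesis
    by (simp add: coord_def pC_diff pC_scale pC_add mult_heis_group pC_complexify)
next
  case False
  then have g: "g \<in> q" and br: "\<forall>u v. heis_bracket u v \<in> q" "\<forall>u\<in>q. \<forall>v\<in>q. heis_bracket u v = 0"
    using assms brackets by auto
  have central: "heis_bracket x y \<in> qC" for x y :: "(complex, 'n) heis"
    by (rule complex_vec_cases [of x], rule complex_vec_cases [of y])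
      (use br in \<open>simp add: heis_bracket_complex subspace_add subspace_diff subspace_q\<close>)
  have q0: "heis_bracket x y = 0" if "x \<in> qC" "y \<in> qC" for x y
    using that br(2) by (auto simp: complexification_def heis_bracket_complex)
  have g': "complexify g \<in> qC" using g subspace_q by simp
  have coord: "coord z = pC z - (1/2) *s heis_bracket (pC z) z" for z
    using pC_qC [OF central] by (simp add: coord_def pC_diff pC_scale)
  have "pC (complexify g \<otimes>\<^bsub>G\<^esub> x) = complexify g + pC x + (1/2) *s heis_bracket (complexify g) x"
    by (simp add: mult_heis_group pC_add pC_scale pC_qC [OF g'] pC_qC [OF central])
  then show ?thesis
    unfolding coord
    by (simp add: mult_heis_group heis_bracket_bilinear q0 [OF pC_in_qC g'] p_q [OF g] vec.scale_right_distrib)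
qed

lemma dim_qC: "vec.dim qC = vec.dim (UNIV :: (complex, 'n) heis set) - vec.dim hC"
proof -
  have sub: "vec.subspace hC" "vec.subspace qC"
    by (simp_all add: subspace_complexification subspace_h subspace_q)
  have "{x + y |x y. x \<in> hC \<and> y \<in> qC} = UNIV"
  proof -
    have "\<exists>a b. x = a + b \<and> a \<in> hC \<and> b \<in> qC" for x
      using minus_pC_in_hC [of x] pC_in_qC [of x] by (intro exI [of _ "x - pC x"] exI [of _ "pC x"]) simp
    then show ?thesis by blast
  qed
  moreover have "hC \<inter> qC = {0}"
  proof -
    have "x = 0" if "x \<in> hC" "x \<in> qC" for x using that pC_eq_0_iff pC_qC by metis
    then show ?thesis using sub vec.subspace_0 by blast
  qed
  ultimately have "vec.dim (UNIV :: (complex, 'n) heis set) = vec.dim hC + vec.dim qC"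
    using vec.dim_sums_Int [OF sub] by simp
  then show ?thesis by simp
qed

text \<open>
  If brackets lie in \<open>h\<close>, the group \<open>Q\<close> may be larger than \<open>q\<close>; the surplus lies in \<open>h\<close> and
  acts trivially.
\<close>

lemma flat_visible_action_coord:
  assumes Q: "subgroup Q (heis_group :: (real, 'n) heis monoid)" "p ` Q = q"
    and "(\<forall>u v. heis_bracket u v \<in> h) \<or> Q \<subseteq> q"
  shows "flat_visible_action G hC coord q (heis_group\<lparr>carrier := Q\<rparr>) p"
proof (intro flat_visible_action.intro flat_coset_space.intro flat_visible_action_axioms.intro)
  show "coord x \<in> qC" for x by (simp add: coord_def pC_in_qC)
  show "group (heis_group\<lparr>carrier := Q\<rparr>)"
    by (rule subgroup.subgroup_is_group [OF Q(1) group_heis_group])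
  have half: "complexify ((1/2) *s v) = (1/2) *s complexify v" for v :: "(real, 'n) heis"
    by (simp add: complexify_def vec_eq_iff)
  show "complexify (g \<otimes>\<^bsub>heis_group\<lparr>carrier := Q\<rparr>\<^esub> g') = complexify g \<otimes>\<^bsub>G\<^esub> complexify g'" for g g'
    by (simp add: mult_heis_group complexify_add half heis_bracket_complexify)
  show "coord (complexify g \<otimes>\<^bsub>G\<^esub> x) = complexify (p g) + coord x"
    if "g \<in> carrier (heis_group\<lparr>carrier := Q\<rparr>)" for g x
    using that assms(3) by (intro coord_translate) auto
  show "complexify \<one>\<^bsub>heis_group\<lparr>carrier := Q\<rparr>\<^esub> = \<one>\<^bsub>G\<^esub>" by simp
  show "p ` carrier (heis_group\<lparr>carrier := Q\<rparr>) = q" using Q(2) by simp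
qed (fact carrier_heis_group fibre_coord subspace_complexification [OF subspace_q] coord_qC
    holomorphic_coord group_heis_group subgroup_hC subspace_q linear_p)+

end

section \<open>The slice and the rank\<close>

lemma heis_bracket_span_eq_0:
  fixes S T :: "(real, 'n::finite) heis set"
  assumes "u \<in> span S" "v \<in> span T" and zero: "\<And>a b. a \<in> S \<Longrightarrow> b \<in> T \<Longrightarrow> heis_bracket a b = 0"
  shows "heis_bracket u v = 0"
proof -
  have "heis_bracket a v = 0" if "a \<in> S" for a
    by (rule linear_eq_0_on_span [OF bounded_linear.linear
          [OF bounded_bilinear.bounded_linear_right [OF bounded_bilinear_heis_bracket(1)]] _ assms(2)])
      (rule zero [OF that])
  then show ?thesis
    by (rule linear_eq_0_on_span [OF bounded_linear.linear
          [OF bounded_bilinear.bounded_linear_left [OF bounded_bilinear_heis_bracket(1)]] _ assms(1)])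
qed

context heisenberg_splitting
begin

text \<open>
  A splitting of a Heisenberg basis is of one of the two kinds when \<open>h\<close> contains \<open>Z\<close> or is spanned by all
  the \<open>X\<^sub>i\<close>. In the second case \<open>q\<close> is spanned by the \<open>Y\<^sub>j\<close> and \<open>Z\<close>, an abelian ideal, which
  is its own exponential group.
\<close>

lemma polarization:
  assumes "Z \<in> A \<or> A = X ` {1..CARD('n)}"
  shows "heisenberg_polarization h q proj"
    and "(\<forall>u v. heis_bracket u v \<in> h) \<or> generate heis_group q \<subseteq> q"
proof -
  have "(\<forall>u v. heis_bracket u v \<in> h) \<or>
      (\<forall>u v. heis_bracket u v \<in> q) \<and> (\<forall>u\<in>h. \<forall>v\<in>h. heis_bracket u v = 0) \<and>
      (\<forall>u\<in>q. \<forall>v\<in>q. heis_bracket u v = 0)"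
  proof (cases "Z \<in> A")
    case True
    then have "heis_bracket u v \<in> h" for u v
      using bracket_in_span_Z [of u v] span_scale [OF span_base [OF True]] by auto
    then show ?thesis by blast
  next
    case False
    then have A: "A = X ` {1..CARD('n)}" using assms by blast
    then have BA: "B - A \<subseteq> Y ` {1..CARD('n)} \<union> {Z}" by (auto simp: basis_set_def)
    have "heis_bracket u v \<in> q" for u v
      using bracket_in_span_Z [of u v] span_scale [OF span_base [of Z "B - A"]] False Z_in_B by auto
    moreover have "heis_bracket u v = 0" if "u \<in> h" "v \<in> h" for u v
      using that by (rule heis_bracket_span_eq_0) (use bracket_XX A in auto)
    moreover have "heis_bracket u v = 0" if "u \<in> q" "v \<in> q" for u v
      using that
    proof (rule heis_bracket_span_eq_0)
      fix a b assume "a \<in> B - A" "b \<in> B - A"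
      then have "a \<in> Y ` {1..CARD('n)} \<union> {Z}" "b \<in> Y ` {1..CARD('n)} \<union> {Z}" using BA by blast+
      then show "heis_bracket a b = 0" using bracket_YY by auto
    qed
    ultimately show ?thesis by blast
  qed
  then show pol: "heisenberg_polarization h q proj"
    by (intro heisenberg_polarization.intro)
      (simp_all add: linear_proj proj_h proj_q proj_in_q minus_proj_in_h)
  show "(\<forall>u v. heis_bracket u v \<in> h) \<or> generate heis_group q \<subseteq> q"
  proof (rule disjCI)
    assume "\<not> generate heis_group q \<subseteq> q"
    moreover have "generate heis_group q \<subseteq> q" if "\<And>u v. u \<in> q \<Longrightarrow> v \<in> q \<Longrightarrow> heis_bracket u v = 0"
    proof (rule group.generate_subgroup_incl [OF group_heis_group subset_refl])
      show "subgroup q heis_group"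
        by (rule subgroup.intro) (auto simp: mult_heis_group that span_add span_neg span_zero)
    qed
    ultimately show "\<forall>u v. heis_bracket u v \<in> h"
      using heisenberg_polarization.brackets [OF pol] by blast
  qed
qed

theorem strongly_visible_quotient:
  assumes "Z \<in> A \<or> A = X ` {1..CARD('n)}"
  defines "M \<equiv> coset_topology heis_group (complexification h)"
    and "\<A> \<equiv> coset_charts heis_group (complexification h)
      (vec.dim (UNIV :: (complex, 'n) heis set) - vec.dim (complexification h))"
    and "L \<equiv> heis_group\<lparr>carrier := generate heis_group q\<rparr>"
    and "act \<equiv> (\<lambda>g C. complexify g <#\<^bsub>heis_group\<^esub> C)"
  shows "strongly_visible M (vec.dim (UNIV :: (complex, 'n) heis set) - vec.dim (complexification h)) \<A> L act"
    and "\<exists>S. visible_slice M \<A> L act (dim q) S"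
proof -
  interpret pol: heisenberg_polarization h q proj by (rule polarization(1) [OF assms(1)])
  have image: "proj ` generate heis_group q = q"
  proof
    show "q \<subseteq> proj ` generate heis_group q"
      using proj_q generate.incl by (metis image_eqI subsetI)
  qed (use proj_in_q in auto)
  have "subgroup (generate heis_group q) (heis_group :: (real, 'n) heis monoid)"
    by (rule group.generate_is_subgroup [OF group_heis_group]) simp
  then interpret vis: flat_visible_action heis_group "complexification h" pol.coord q L proj
    unfolding L_def by (rule pol.flat_visible_action_coord [OF _ image polarization(2) [OF assms(1)]])
  show "strongly_visible M (vec.dim (UNIV :: (complex, 'n) heis set) - vec.dim (complexification h)) \<A> L act"
    using vis.strongly_visible_M unfolding M_def \<A>_def act_def pol.dim_qC .
  show "\<exists>S. visible_slice M \<A> L act (dim q) S"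
    using vis.visible_slice_slice unfolding M_def \<A>_def act_def pol.dim_qC by blast
qed

text \<open>
  If \<open>m < n\<close>, the last pair of basis vectors commutes with \<open>h\<close> and has the bracket \<open>Z \<notin> h\<close>.
\<close>

lemma multiplicity_free_imp_maximal:
  assumes A: "A = X ` {1..m}" and m: "m \<le> CARD('n)"
    and lie: "lie_subalgebra h" and invariant: "invariant_measure heis_group h \<mu>"
    and mf: "multiplicity_free heis_group \<mu> (quasi_regular heis_group)"
  shows "m = CARD('n)"
proof (rule ccontr)
  assume "m \<noteq> CARD('n)"
  then have less: "m < CARD('n)" using m by simp
  let ?N = "CARD('n)"
  have N: "?N \<in> {1..CARD('n)}" using less by simp
  interpret invariant_coset_measure h \<mu> using lie invariant by unfold_locales
  have zero: "heis_bracket u b = 0" if "u \<in> h" and "b = X ?N \<or> b = Y ?N" for u b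
    by (rule heis_bracket_span_eq_0 [OF \<open>u \<in> h\<close> span_base [of b "{b}"]])
      (use that(2) less N A bracket_XX bracket_XY in auto)
  have "Z \<notin> h"
  proof -
    have "Z \<in> B - A" using Z_in_B X_neq_Z A less by fastforce
    then show ?thesis using B_minus_h by blast
  qed
  moreover have "heis_bracket (X ?N) (Y ?N) = Z" using bracket_XY [OF N N] by simp
  ultimately have "\<not> multiplicity_free heis_group \<mu> (quasi_regular heis_group)"
    using not_multiplicity_free [of "X ?N" "Y ?N"] zero by (simp add: centralizes_h_def)
  then show False using mf by simp
qed

end

theorem theorem8p11:
  fixes h H q Q :: "(real, 'n::finite) heis set"
    and X Y :: "nat \<Rightarrow> (real, 'n) heis" and Z :: "(real, 'n) heis"
    and \<mu> :: "(real, 'n) heis set measure"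
    and HC :: "(complex, 'n) heis set"
    and d :: nat
  assumes "lie_subalgebra h" and "H = heis_exp ` h"
    and "H \<noteq> {\<one>\<^bsub>heis_group\<^esub>}" and "H \<noteq> carrier heis_group"
    and "adapted_basis h X Y Z"
    and "q = span (basis_set X Y Z - h)"
    and "Q = generate heis_group (heis_exp ` q)"
    and "HC = heis_exp ` complexification h"
    and "d = vec.dim (UNIV :: (complex, 'n) heis set) - vec.dim (complexification h)"
    and "invariant_measure heis_group H \<mu>"
    and "multiplicity_free heis_group \<mu> (quasi_regular heis_group)"
  shows "rank_Supp X Y Z q = DIM((real, 'n) heis) - dim h \<and>
    (let M = coset_topology heis_group HC;
         \<A> = coset_charts heis_group HC d;
         L = heis_group\<lparr>carrier := Q\<rparr>;
         act = (\<lambda>g C. complexify g <#\<^bsub>heis_group\<^esub> C)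
     in strongly_visible M d \<A> L act \<and>
        (\<exists>S. visible_slice M \<A> L act (rank_Supp X Y Z q) S))"
proof -
  have basis: "heisenberg_basis X Y Z" using assms(5) by (simp add: adapted_basis_def)
  have invariant: "invariant_measure heis_group h \<mu>" using assms(2,10) by simp
  obtain A where A: "h = span A" "A \<subseteq> basis_set X Y Z" and cases: "Z \<in> A \<or> A = X ` {1..CARD('n)}"
  proof -
    consider "h = span {Z}"
      | p r where "p \<le> r" "r \<le> CARD('n)" "h = span (X ` {1..p} \<union> Y ` {1..r} \<union> {Z})"
      | m where "m \<le> CARD('n)" "h = span (X ` {1..m} \<union> {Z})"
      | m where "m \<le> CARD('n)" "h = span (X ` {1..m})"
      using assms(5) unfolding adapted_basis_def by blast
    then show thesis
    proof cases
      case 1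
      then show thesis by (intro that [of "{Z}"]) (auto simp: basis_set_def)
    next
      case 2
      then show thesis
        by (intro that [of "X ` {1..p} \<union> Y ` {1..r} \<union> {Z}"]) (auto simp: basis_set_def)
    next
      case 3
      then show thesis by (intro that [of "X ` {1..m} \<union> {Z}"]) (auto simp: basis_set_def)
    next
      case 4
      then have sub: "X ` {1..m} \<subseteq> basis_set X Y Z" by (auto simp: basis_set_def)
      then interpret heisenberg_splitting X Y Z "X ` {1..m}" using basis by unfold_locales
      have "m = CARD('n)"
        using multiplicity_free_imp_maximal [OF refl \<open>m \<le> _\<close>] assms(1,11) invariant 4 by simp
      then show thesis using that [OF \<open>h = _\<close> sub] by simp
    qed
  qed
  interpret heisenberg_splitting X Y Z A using basis A(2) by unfold_locales
  have q: "q = span (B - A)" using assms(6) B_minus_h A(1) by simp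
  have Q: "Q = generate heis_group (span (B - A))" using assms(7) q by simp
  have HC: "HC = complexification (span A)" using assms(8) A(1) by simp
  show ?thesis
    unfolding Let_def HC Q q assms(9) A(1) rank_Supp_eq
    using strongly_visible_quotient [OF cases] dim_diff by simp
qed

end
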